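(* Let $D=K((G))$ be the Mal'cev--Neumann division ring described in the context, let $v:D^*\to G$ be the valuation $v(\alpha)=\min\mathrm{supp}(\alpha)$, let $x=x_2^{-1}$, and let $H=\{a\in D^* : \exists\, n\in\mathbb{Z},\ v(a)\ge v(x^n)\}\cup\{0\}$. Then $H$ is a proper subring of $D$, its group of units $H^*$ is a normal subgroup of $D^*$, and $H^*$ is not commutative.
   Context: Let $G=\bigoplus_{i=1}^\infty\mathbb{Z}$ be the free abelian group of countably infinite rank, totally ordered lexicographically: $(n_1,n_2,\ldots)<(m_1,m_2,\ldots)$ iff there is $k\ge 1$ with $n_i=m_i$ for all $i<k$ and $n_k<m_k$. From now on $G$ is written multiplicatively, and $x_i\in G$ denotes the element with $1$ in position $i$ and $0$ elsewhere. Let $p_1<p_2<\cdots$ be an increasing infinite sequence of primes and $K=\mathbb{Q}(\sqrt{p_1},\sqrt{p_2},\ldots)\subseteq\mathbb{R}$. $G$ acts on $K$ by $\mathbb{Q}$-automorphisms $c\mapsto c^g$: for $g=(n_1,n_2,\ldots)$, $(\sqrt{p_i})^g=(-1)^{n_i}\sqrt{p_i}$ for all $i$. $D=K((G))$ is the set of formal sums $\alpha=\sum_{g\in G}\alpha_g g$ with $\alpha_g\in K$ and with support $\mathrm{supp}(\alpha)=\{g\in G:\alpha_g\neq 0\}$ well-ordered, with addition $\alpha+\beta=\sum_g(\alpha_g+\beta_g)g$ and multiplication $\alpha\cdot\beta=\sum_{g}\big(\sum_{uv=g}\alpha_u\beta_v^{u}\big)g$; it is a division ring. The map $v(\alpha)=\min\mathrm{supp}(\alpha)$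 on $D^*=D\setminus\{0\}$ satisfies $v(ab)=v(a)v(b)$ for all $a,b\in D^*$ and $v(a+b)\ge\min\{v(a),v(b)\}$ whenever $a,b,a+b\in D^*$. $H^*$ denotes the group of units of $H$. *)

theory Defs
  imports
    "HOL-Algebra.Algebra"
    "HOL-Algebra.Algebraic_Closure_Type"
    "HOL-Library.Poly_Mapping"
    "HOL-Computational_Algebra.Primes"
    Complex_Main
begin

hide_const (open) Divisibility.prime

text \<open>
  The group \<open>G\<close> is written additively, as the type of finitely supported maps \<open>nat \<Rightarrow>\<^sub>0 int\<close>;
  its library order is the lexicographic one, the least differing index being decisive.
  Positions are numbered from \<open>0\<close>, so \<open>gen i\<close> is the element usually written
  \<open>x\<^bsub>i+1\<^esub>\<close>, and likewise \<open>p i\<close> is the prime \<open>p\<^bsub>i+1\<^esub>\<close>.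
\<close>

type_synonym G = "nat \<Rightarrow>\<^sub>0 int"

definition gen :: "nat \<Rightarrow> G" where
  "gen i = Poly_Mapping.single i 1"

definition multiquadratic_field :: "(nat \<Rightarrow> nat) \<Rightarrow> real set" where
  "multiquadratic_field p =
     generate_field (ring_of_type_algebra :: real ring) (\<rat> \<union> range (\<lambda>i. sqrt (real (p i))))"

definition Q_automorphism :: "real set \<Rightarrow> (real \<Rightarrow> real) \<Rightarrow> bool" where
  "Q_automorphism K \<sigma> \<longleftrightarrow>
     \<sigma> \<in> ring_iso ((ring_of_type_algebra :: real ring)\<lparr>carrier := K\<rparr>)
                  ((ring_of_type_algebra :: real ring)\<lparr>carrier := K\<rparr>) \<and>
     (\<forall>q\<in>\<rat>. \<sigma> q = q)"

text \<open>
  For distinct primes \<open>p i\<close> the automorphism chosen here exists, and it is uniquely determined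
  on \<open>multiquadratic_field p\<close>; its values elsewhere are never used.
\<close>

definition act :: "(nat \<Rightarrow> nat) \<Rightarrow> G \<Rightarrow> real \<Rightarrow> real" where
  "act p g = (SOME \<sigma>. Q_automorphism (multiquadratic_field p) \<sigma> \<and>
     (\<forall>i. \<sigma> (sqrt (real (p i))) = (-1) powi (Poly_Mapping.lookup g i) * sqrt (real (p i))))"

definition supp :: "('g \<Rightarrow> 'k::zero) \<Rightarrow> 'g set" where
  "supp \<alpha> = {g. \<alpha> g \<noteq> 0}"

text \<open>
  The formal sum with coefficients \<open>\<alpha> g\<close> is represented by the function \<open>\<alpha>\<close>. In the product the
  index set is restricted to the supports, which only discards zero terms and makes it finite when the
  supports are well-ordered (\<open>sum\<close> is \<open>0\<close> over infinite sets).
\<close>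

definition malcev_neumann ::
  "'k::field set \<Rightarrow> ('g::linordered_ab_group_add \<Rightarrow> 'k \<Rightarrow> 'k) \<Rightarrow> ('g \<Rightarrow> 'k) ring" where
  "malcev_neumann K \<phi> =
     \<lparr> carrier = {\<alpha>. range \<alpha> \<subseteq> K \<and> well_order_on (supp \<alpha>) (relation_of (\<le>) (supp \<alpha>))},
       monoid.mult = (\<lambda>\<alpha> \<beta> g.
         \<Sum>(u, v) \<in> {(u, v). u \<in> supp \<alpha> \<and> v \<in> supp \<beta> \<and> u + v = g}. \<alpha> u * \<phi> u (\<beta> v)),
       one = (\<lambda>g. if g = 0 then 1 else 0),
       ring.zero = (\<lambda>g. 0),
       add = (\<lambda>\<alpha> \<beta> g. \<alpha> g + \<beta> g) \<rparr>"

definition MN :: "(nat \<Rightarrow> nat) \<Rightarrow> (G \<Rightarrow> real) ring" where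
  "MN p = malcev_neumann (multiquadratic_field p) (act p)"

text \<open>The formal sum with the single term \<open>h\<close>.\<close>

definition single_term :: "'g \<Rightarrow> 'g \<Rightarrow> 'k::zero_neq_one" where
  "single_term h = (\<lambda>g. if g = h then 1 else 0)"

text \<open>The minimum of the support; only meaningful for nonzero \<open>\<alpha>\<close> with well-ordered support.\<close>

definition val :: "('g::linorder \<Rightarrow> 'k::zero) \<Rightarrow> 'g" where
  "val \<alpha> = (LEAST g. g \<in> supp \<alpha>)"

end

theory Submission
  imports Defs
begin

text \<open>
  Write \<open>w g\<close> for the first coordinate of \<open>g\<close>. In the lexicographic order the powers of
  \<open>x = x\<^sub>2\<^sup>-\<^sup>1\<close> are cofinal downwards among the \<open>g\<close> with \<open>w g \<ge> 0\<close>, and no \<open>g\<close> with \<open>w g < 0\<close> lies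
  above any of them. Hence \<open>H\<close> consists of \<open>0\<close> and the \<open>\<alpha>\<close> with \<open>w (v \<alpha>) \<ge> 0\<close>. As \<open>w\<close> is a monotone
  homomorphism \<open>G \<rightarrow> \<int>\<close>, the composition \<open>w \<circ> v\<close> is again a valuation and \<open>H\<close> is its valuation ring.
  The units of \<open>H\<close> are the kernel of the homomorphism \<open>w \<circ> v\<close> from \<open>D\<^sup>*\<close> to \<open>\<int>\<close>, therefore normal. The
  series \<open>x\<^sub>1\<^sup>-\<^sup>1\<close> is outside \<open>H\<close>. The constant \<open>sqrt p\<^sub>2\<close> and the monomial \<open>x\<^sub>2\<close> are units of \<open>H\<close> that do
  not commute, since \<open>x\<^sub>2\<close> changes the sign of \<open>sqrt p\<^sub>2\<close>.

  (With positions counted from \<open>0\<close>, \<open>x\<^sub>2\<close> is \<open>gen 1\<close> and \<open>p\<^sub>2\<close> is \<open>p 1\<close>.)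

  This argument rests on two facts about the construction of \<open>D\<close>.

  First, \<open>D\<close> is a division ring. Products exist and are associative because sums of two well-ordered
  sets are well-ordered with finite fibres (\<open>wfp_on_sumset\<close>, \<open>finite_sumset_fibre\<close>). An inverse
  is computed by recursion along its prospective support (\<open>right_inverse\<close>), which is well-ordered by
  Neumann's lemma (\<open>wfp_on_sums_nonneg\<close>).

  Second, \<open>G\<close> acts on \<open>K\<close>, that is, every choice of signs of the \<open>sqrt p\<^sub>i\<close> is realised by exactly one
  automorphism of \<open>K\<close>. Uniqueness holds as the roots generate \<open>K\<close>, and gives the composition
  law of the action. Existence holds because each root is of degree two over the field generated by
  the previous ones (\<open>sqrt_prod_notin_tower\<close>), so that automorphisms extend step by step
  (\<open>extend_rat_hom\<close>).
\<close>

section \<open>Well-ordered subsets of an ordered group\<close>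

lemma wfp_on_less_iff_wf:
  fixes A :: "'a::linorder set"
  shows "wfp_on A (<) \<longleftrightarrow> wf {(x, y). x < y \<and> x \<in> A \<and> y \<in> A}"
  using wfp_on_wf_on_eq[of A "{(x, y). x < y}"] wf_on_iff_wf[of A "{(x, y). x < y}"] by simp

lemma well_order_on_relation_of_iff:
  fixes A :: "'a::linorder set"
  shows "well_order_on A (relation_of (\<le>) A) \<longleftrightarrow> wfp_on A (<)"
proof -
  have "linear_order_on A (relation_of (\<le>) A)"
    by (auto simp: order_on_defs relation_of_def refl_on_def trans_def antisym_def total_on_def)
  moreover have "relation_of (\<le>) A - Id = {(x, y). x < y \<and> x \<in> A \<and> y \<in> A}"
    by (auto simp: relation_of_def)
  ultimately show ?thesis
    by (simp add: well_order_on_def wfp_on_less_iff_wf)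
qed

lemma wfp_on_less_iff_no_descent:
  fixes A :: "'a::linorder set"
  shows "wfp_on A (<) \<longleftrightarrow> (\<nexists>f::nat \<Rightarrow> 'a. \<forall>n. f n \<in> A \<and> f (Suc n) < f n)"
  unfolding wfp_on_less_iff_wf wf_iff_no_infinite_down_chain by auto

lemma wfp_on_less_no_descent:
  fixes f :: "nat \<Rightarrow> 'a::linorder"
  assumes "wfp_on A (<)" "\<And>n. f n \<in> A" "\<And>n. f (Suc n) < f n"
  shows False
  using assms unfolding wfp_on_less_iff_no_descent by auto

lemma lift_Suc_descent:
  fixes f :: "nat \<Rightarrow> 'a::order"
  assumes "\<And>n. f (Suc n) < f n" "m < n"
  shows "f n < f m"
  using assms(2) by (induction n) (use assms(1) in \<open>auto simp: less_Suc_eq intro: less_trans\<close>)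

lemma wfp_on_less_least:
  fixes A :: "'a::linorder set"
  assumes "wfp_on A (<)" "B \<subseteq> A" "B \<noteq> {}"
  obtains m where "m \<in> B" "\<And>x. x \<in> B \<Longrightarrow> m \<le> x"
  using assms unfolding wfp_on_iff_ex_minimal by (metis linorder_not_le)

text \<open>
  A monotone subsequence always exists; in a well-ordered set a non-increasing one is eventually
  constant, so that a tail of it is non-decreasing as well.
\<close>

lemma wfp_on_less_nondecreasing_subseq:
  fixes f :: "nat \<Rightarrow> 'a::linorder"
  assumes "wfp_on A (<)" "\<And>n. f n \<in> A"
  obtains r :: "nat \<Rightarrow> nat" where "strict_mono r" "mono (\<lambda>n. f (r n))"
proof -
  obtain s :: "nat \<Rightarrow> nat" where s: "strict_mono s" "monoseq (\<lambda>n. f (s n))"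
    using seq_monosub by blast
  show thesis
  proof (cases "mono (\<lambda>n. f (s n))")
    case True
    with s show thesis using that by blast
  next
    case False
    with s(2) have "antimono (\<lambda>n. f (s n))" by (simp add: monoseq_iff)
    then have dec: "f (s n) \<le> f (s m)" if "m \<le> n" for m n using that by (rule antimonoD)
    have "range (\<lambda>n. f (s n)) \<subseteq> A" "range (\<lambda>n. f (s n)) \<noteq> {}" using assms(2) by auto
    then obtain m where m: "m \<in> range (\<lambda>n. f (s n))" "\<And>x. x \<in> range (\<lambda>n. f (s n)) \<Longrightarrow> m \<le> x"
      using wfp_on_less_least[OF assms(1)] by metis
    then obtain N where N: "\<And>n. f (s N) \<le> f (s n)" by auto
    have "f (s (N + n)) = f (s N)" for n
      using dec[of N "N + n"] N[of "N + n"] by simp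
    then have "mono (\<lambda>n. f (s (N + n)))" by (simp add: mono_def)
    moreover have "strict_mono (\<lambda>n. s (N + n))"
      using s(1) by (simp add: strict_mono_def)
    ultimately show thesis using that by blast
  qed
qed

lemma wfp_on_less_singleton: "wfp_on {a::'a::linorder} (<)"
  by (auto simp: wfp_on_iff_ex_minimal subset_singleton_iff)

lemma wfp_on_Un:
  fixes A B :: "'a::linorder set"
  assumes "wfp_on A (<)" "wfp_on B (<)"
  shows "wfp_on (A \<union> B) (<)"
  unfolding wfp_on_iff_ex_minimal
proof (intro allI impI)
  fix C assume C: "C \<subseteq> A \<union> B" "C \<noteq> {}"
  show "\<exists>z\<in>C. \<forall>y. y < z \<longrightarrow> y \<notin> C"
  proof (cases "C \<inter> A = {} \<or> C \<inter> B = {}")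
    case True
    with C have "C \<subseteq> A \<or> C \<subseteq> B" by blast
    with assms C(2) show ?thesis unfolding wfp_on_iff_ex_minimal by metis
  next
    case False
    obtain a where a: "a \<in> C \<inter> A" "\<And>x. x \<in> C \<inter> A \<Longrightarrow> a \<le> x"
      using wfp_on_less_least[OF assms(1), of "C \<inter> A"] False by auto
    obtain b where b: "b \<in> C \<inter> B" "\<And>x. x \<in> C \<inter> B \<Longrightarrow> b \<le> x"
      using wfp_on_less_least[OF assms(2), of "C \<inter> B"] False by auto
    have "min a b \<le> x" if "x \<in> C" for x
      using that C(1) a(2)[of x] b(2)[of x] by (auto simp: min_le_iff_disj)
    moreover have "min a b \<in> C" using a(1) b(1) by (simp add: min_def)
    ultimately show ?thesis by (meson linorder_not_le)
  qed
qed

lemma wfp_on_translate: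
  fixes A :: "'a::linordered_ab_group_add set"
  assumes "wfp_on A (<)"
  shows "wfp_on {x. m + x \<in> A} (<)"
  unfolding wfp_on_less_iff_no_descent
proof
  assume "\<exists>f::nat \<Rightarrow> 'a. \<forall>n. f n \<in> {x. m + x \<in> A} \<and> f (Suc n) < f n"
  then obtain f :: "nat \<Rightarrow> 'a" where "\<And>n. m + f n \<in> A" "\<And>n. f (Suc n) < f n" by auto
  with wfp_on_less_no_descent[of A "\<lambda>n. m + f n", OF assms] show False by simp
qed

definition sumset :: "'a::plus set \<Rightarrow> 'a set \<Rightarrow> 'a set" where
  "sumset A B = {u + v | u v. u \<in> A \<and> v \<in> B}"

lemma sumsetI: "u \<in> A \<Longrightarrow> v \<in> B \<Longrightarrow> u + v \<in> sumset A B"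
  unfolding sumset_def by blast

text \<open>
  Along an infinite descent \<open>u\<^sub>n + v\<^sub>n\<close> one may assume \<open>u\<^sub>n\<close> non-decreasing, and then \<open>v\<^sub>n\<close>
  descends.
\<close>

lemma wfp_on_sumset:
  fixes A B :: "'a::linordered_ab_group_add set"
  assumes A: "wfp_on A (<)" and B: "wfp_on B (<)"
  shows "wfp_on (sumset A B) (<)"
  unfolding wfp_on_less_iff_no_descent
proof
  assume "\<exists>f::nat \<Rightarrow> 'a. \<forall>n. f n \<in> sumset A B \<and> f (Suc n) < f n"
  then obtain f :: "nat \<Rightarrow> 'a" where f: "\<And>n. f n \<in> sumset A B" "\<And>n. f (Suc n) < f n" by blast
  have "\<exists>u. u \<in> A \<and> f n - u \<in> B" for n using f(1)[of n] unfolding sumset_def by auto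
  then obtain u where u: "\<And>n. u n \<in> A" "\<And>n. f n - u n \<in> B" by metis
  obtain r :: "nat \<Rightarrow> nat" where r: "strict_mono r" "mono (\<lambda>n. u (r n))"
    using wfp_on_less_nondecreasing_subseq[of A u, OF A u(1)] .
  have "f (r (Suc n)) < f (r n)" for n
    using lift_Suc_descent[of f, OF f(2)] r(1) by (simp add: strict_mono_def)
  moreover have "u (r n) \<le> u (r (Suc n))" for n using r(2) by (simp add: mono_def)
  ultimately have "f (r (Suc n)) - u (r (Suc n)) < f (r n) - u (r n)" for n
    by (rule less_le_trans[OF diff_strict_right_mono diff_left_mono])
  then show False using wfp_on_less_no_descent[of B "\<lambda>n. f (r n) - u (r n)", OF B u(2)] by blast
qed

text \<open>
  An infinite set of such \<open>u\<close> would contain an increasing sequence, and the complements \<open>g - u\<close>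
  would descend in \<open>B\<close>.
\<close>

lemma finite_sumset_fibre:
  fixes A B :: "'a::linordered_ab_group_add set"
  assumes A: "wfp_on A (<)" and B: "wfp_on B (<)"
  shows "finite {u \<in> A. g - u \<in> B}"
proof (rule ccontr)
  assume "infinite {u \<in> A. g - u \<in> B}"
  then obtain f :: "nat \<Rightarrow> 'a" where f: "inj f" "range f \<subseteq> {u \<in> A. g - u \<in> B}"
    using infinite_countable_subset by blast
  then have fA: "\<And>n. f n \<in> A" and fB: "\<And>n. g - f n \<in> B" by auto
  obtain r :: "nat \<Rightarrow> nat" where r: "strict_mono r" "mono (\<lambda>n. f (r n))"
    using wfp_on_less_nondecreasing_subseq[of A f, OF A fA] .
  have "f (r n) \<noteq> f (r (Suc n))" for n
    using f(1) r(1) by (metis inj_eq n_not_Suc_n strict_mono_eq)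
  with r(2) have "f (r n) < f (r (Suc n))" for n by (simp add: mono_def order_less_le)
  then have "g - f (r (Suc n)) < g - f (r n)" for n by simp
  then show False using wfp_on_less_no_descent[of B "\<lambda>n. g - f (r n)", OF B fB] by blast
qed

text \<open>
  Neumann's lemma on the submonoid generated by a well-ordered set of non-negative elements, by a
  minimal bad sequence. Call a sum bad if it starts an infinite descent of sums, and build a descent
  of bad sums in which each word is as short as possible. Removing the first letter of each word
  after the first gives sums that are not bad, by minimality; but the first letters have a non-decreasing
  subsequence, along which the remaining sums descend.
\<close>

lemma wfp_on_sums_nonneg:
  fixes A :: "'a::linordered_ab_group_add set"
  assumes A: "wfp_on A (<)" and nonneg: "\<And>a. a \<in> A \<Longrightarrow> 0 \<le> a"
  shows "wfp_on (sum_list ` lists A) (<)"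
proof (rule ccontr)
  define S where "S = sum_list ` lists A"
  define bad where
    "bad s \<longleftrightarrow> (\<exists>f::nat \<Rightarrow> 'a. f 0 = s \<and> (\<forall>n. f n \<in> S \<and> f (Suc n) < f n))" for s
  assume "\<not> wfp_on (sum_list ` lists A) (<)"
  then obtain f :: "nat \<Rightarrow> 'a" where f: "\<And>n. f n \<in> S" "\<And>n. f (Suc n) < f n"
    unfolding wfp_on_less_iff_no_descent S_def by blast
  have bad_ex: "\<exists>w\<in>lists A. bad (sum_list w)"
  proof -
    have "bad (f 0)" unfolding bad_def using f by blast
    with f(1)[of 0] show ?thesis unfolding S_def by auto
  qed
  have bad_less: "\<exists>w\<in>lists A. bad (sum_list w) \<and> sum_list w < s" if "bad s" for s
  proof -
    from that obtain h :: "nat \<Rightarrow> 'a" where h: "h 0 = s" "\<And>n. h n \<in> S \<and> h (Suc n) < h n"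
      unfolding bad_def by blast
    have "bad (h 1)" unfolding bad_def using h by (intro exI[of _ "\<lambda>n. h (Suc n)"]) auto
    moreover have "h 1 < s" using h(1) h(2)[of 0] by simp
    ultimately show ?thesis using h(2)[of 1] unfolding S_def by auto
  qed
  have "\<exists>w::nat \<Rightarrow> 'a list. \<forall>n. (w n \<in> lists A \<and> bad (sum_list (w n))) \<and>
    (sum_list (w (Suc n)) < sum_list (w n) \<and>
     (\<forall>v\<in>lists A. bad (sum_list v) \<longrightarrow> sum_list v < sum_list (w n) \<longrightarrow>
        length (w (Suc n)) \<le> length v))"
  proof (rule dependent_nat_choice)
    show "\<exists>x. x \<in> lists A \<and> bad (sum_list x)" using bad_ex by blast
  next
    fix x :: "'a list" and n :: nat
    assume "x \<in> lists A \<and> bad (sum_list x)"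
    then obtain y where "y \<in> lists A \<and> bad (sum_list y) \<and> sum_list y < sum_list x"
      using bad_less by blast
    then show "\<exists>y. (y \<in> lists A \<and> bad (sum_list y)) \<and> sum_list y < sum_list x \<and>
      (\<forall>v\<in>lists A. bad (sum_list v) \<longrightarrow> sum_list v < sum_list x \<longrightarrow> length y \<le> length v)"
      using ex_has_least_nat
        [of "\<lambda>y. y \<in> lists A \<and> bad (sum_list y) \<and> sum_list y < sum_list x" y length] by blast
  qed
  then obtain w :: "nat \<Rightarrow> 'a list" where
    w: "\<And>n. w n \<in> lists A" "\<And>n. bad (sum_list (w n))"
       "\<And>n. sum_list (w (Suc n)) < sum_list (w n)"
    and short: "\<And>n v. v \<in> lists A \<Longrightarrow> bad (sum_list v) \<Longrightarrow> sum_list v < sum_list (w n) \<Longrightarrow>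
        length (w (Suc n)) \<le> length v"
    by blast
  have nonempty: "w n \<noteq> []" for n
  proof
    assume "w n = []"
    then have "sum_list (w (Suc n)) < 0" using w(3)[of n] by simp
    moreover have "0 \<le> sum_list (w (Suc n))"
      using w(1)[of "Suc n"] nonneg by (intro sum_list_nonneg) auto
    ultimately show False by simp
  qed
  define a where "a n = hd (w (Suc n))" for n
  define t where "t n = tl (w (Suc n))" for n
  have split: "w (Suc n) = a n # t n" for n
    unfolding a_def t_def using nonempty by simp
  have aA: "a n \<in> A" and tA: "t n \<in> lists A" for n
    using w(1)[of "Suc n"] unfolding split by auto
  have not_bad: "\<not> bad (sum_list (t n))" for n
  proof
    assume "bad (sum_list (t n))"
    moreover have "sum_list (t n) < sum_list (w n)"
    proof (rule le_less_trans)
      show "sum_list (t n) \<le> sum_list (w (Suc n))" using nonneg[OF aA[of n]] by (simp add: split)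
    qed (rule w(3))
    ultimately have "length (w (Suc n)) \<le> length (t n)" using short tA by blast
    then show False unfolding split by simp
  qed
  obtain r :: "nat \<Rightarrow> nat" where r: "strict_mono r" "mono (\<lambda>n. a (r n))"
    using wfp_on_less_nondecreasing_subseq[of A a, OF A aA] .
  have "sum_list (t (r (Suc n))) < sum_list (t (r n))" for n
  proof -
    have "sum_list (w (Suc (r (Suc n)))) < sum_list (w (Suc (r n)))"
      using lift_Suc_descent[of "\<lambda>n. sum_list (w n)", OF w(3)] r(1)
      by (simp add: strict_mono_def)
    then have "a (r (Suc n)) + sum_list (t (r (Suc n))) < a (r n) + sum_list (t (r n))"
      unfolding split by simp
    moreover have "a (r n) \<le> a (r (Suc n))" using r(2) by (simp add: mono_def)
    ultimately show ?thesis using add_mono linorder_not_le by blast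
  qed
  moreover have "sum_list (t (r n)) \<in> S" for n using tA unfolding S_def by blast
  ultimately have "bad (sum_list (t (r 0)))"
    unfolding bad_def by (intro exI[of _ "\<lambda>n. sum_list (t (r n))"]) auto
  with not_bad show False by blast
qed

section \<open>The division ring of series with well-ordered support\<close>

text \<open>
  The coefficients form a subfield of an ambient field, on which the exponents act by field
  automorphisms. The maps \<open>\<phi> g\<close> are constrained on \<open>K\<close> only, since the automorphisms of interest are
  arbitrary elsewhere.
\<close>

locale skew_series =
  fixes K :: "'k::field set" and \<phi> :: "'g::linordered_ab_group_add \<Rightarrow> 'k \<Rightarrow> 'k"
  assumes K_one: "1 \<in> K"
    and K_diff: "a \<in> K \<Longrightarrow> b \<in> K \<Longrightarrow> a - b \<in> K"
    and K_mult: "a \<in> K \<Longrightarrow> b \<in> K \<Longrightarrow> a * b \<in> K"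
    and K_inverse: "a \<in> K \<Longrightarrow> inverse a \<in> K"
    and phi_closed: "a \<in> K \<Longrightarrow> \<phi> g a \<in> K"
    and phi_add: "a \<in> K \<Longrightarrow> b \<in> K \<Longrightarrow> \<phi> g (a + b) = \<phi> g a + \<phi> g b"
    and phi_mult: "a \<in> K \<Longrightarrow> b \<in> K \<Longrightarrow> \<phi> g (a * b) = \<phi> g a * \<phi> g b"
    and phi_1: "\<phi> g 1 = 1"
    and phi_zero_exp: "a \<in> K \<Longrightarrow> \<phi> 0 a = a"
    and phi_plus_exp: "a \<in> K \<Longrightarrow> \<phi> (g + h) a = \<phi> g (\<phi> h a)"
begin

abbreviation D :: "('g \<Rightarrow> 'k) ring" where
  "D \<equiv> malcev_neumann K \<phi>"

lemma K_zero: "0 \<in> K"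
  using K_diff[OF K_one K_one] by simp

lemma K_uminus: "a \<in> K \<Longrightarrow> - a \<in> K"
  using K_diff[OF K_zero] by simp

lemma K_add: "a \<in> K \<Longrightarrow> b \<in> K \<Longrightarrow> a + b \<in> K"
  using K_diff[of a "- b"] K_uminus[of b] by simp

lemma K_sum: "(\<And>i. i \<in> I \<Longrightarrow> f i \<in> K) \<Longrightarrow> sum f I \<in> K"
  by (induction I rule: infinite_finite_induct) (auto intro: K_zero K_add)

lemma phi_0: "\<phi> g 0 = 0"
  using phi_add[OF K_zero K_zero, of g] by (metis add.right_neutral add_left_cancel)

lemma phi_sum: "(\<And>i. i \<in> I \<Longrightarrow> f i \<in> K) \<Longrightarrow> \<phi> g (sum f I) = (\<Sum>i\<in>I. \<phi> g (f i))"
  by (induction I rule: infinite_finite_induct) (auto simp: phi_0 phi_add K_sum)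

lemma phi_inverse_exp:
  assumes "a \<in> K"
  shows "\<phi> (- g) (\<phi> g a) = a" "\<phi> g (\<phi> (- g) a) = a"
  using phi_plus_exp[OF assms, of "- g" g] phi_plus_exp[OF assms, of g "- g"]
  by (simp_all add: phi_zero_exp assms)

lemma phi_eq_0_iff: "a \<in> K \<Longrightarrow> \<phi> g a = 0 \<longleftrightarrow> a = 0"
  using phi_inverse_exp(1)[of a g] by (auto simp: phi_0)

lemma carrier_iff: "\<alpha> \<in> carrier D \<longleftrightarrow> (\<forall>g. \<alpha> g \<in> K) \<and> wfp_on (supp \<alpha>) (<)"
  by (auto simp: malcev_neumann_def well_order_on_relation_of_iff)

lemma coeff_in_K: "\<alpha> \<in> carrier D \<Longrightarrow> \<alpha> g \<in> K"
  by (simp add: carrier_iff)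

lemma wfp_on_supp: "\<alpha> \<in> carrier D \<Longrightarrow> wfp_on (supp \<alpha>) (<)"
  by (simp add: carrier_iff)

lemma add_eq: "\<alpha> \<oplus>\<^bsub>D\<^esub> \<beta> = (\<lambda>g. \<alpha> g + \<beta> g)"
  by (simp add: malcev_neumann_def)

lemma zero_eq: "\<zero>\<^bsub>D\<^esub> = (\<lambda>g. 0)"
  by (simp add: malcev_neumann_def)

lemma one_eq: "\<one>\<^bsub>D\<^esub> = single_term 0"
  by (simp add: malcev_neumann_def single_term_def fun_eq_iff)

text \<open>
  Enlarging the index set beyond the supports makes it possible to compare products whose
  factors have different supports.
\<close>

lemma mult_coeff:
  assumes A: "wfp_on A (<)" "supp \<alpha> \<subseteq> A" and B: "wfp_on B (<)" "supp \<beta> \<subseteq> B"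
  shows "(\<alpha> \<otimes>\<^bsub>D\<^esub> \<beta>) g = (\<Sum>u\<in>{u \<in> A. g - u \<in> B}. \<alpha> u * \<phi> u (\<beta> (g - u)))"
proof -
  have "(\<alpha> \<otimes>\<^bsub>D\<^esub> \<beta>) g =
      (\<Sum>(u, v)\<in>{(u, v). u \<in> supp \<alpha> \<and> v \<in> supp \<beta> \<and> u + v = g}. \<alpha> u * \<phi> u (\<beta> v))"
    by (simp add: malcev_neumann_def)
  also have "\<dots> = (\<Sum>u\<in>{u \<in> supp \<alpha>. g - u \<in> supp \<beta>}. \<alpha> u * \<phi> u (\<beta> (g - u)))"
    by (rule sum.reindex_bij_witness[where i = "\<lambda>u. (u, g - u)" and j = fst]) auto
  also have "\<dots> = (\<Sum>u\<in>{u \<in> A. g - u \<in> B}. \<alpha> u * \<phi> u (\<beta> (g - u)))"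
    using A B by (intro sum.mono_neutral_left finite_sumset_fibre) (auto simp: supp_def phi_0)
  finally show ?thesis .
qed

lemma supp_mult:
  assumes "\<alpha> \<in> carrier D" "\<beta> \<in> carrier D"
  shows "supp (\<alpha> \<otimes>\<^bsub>D\<^esub> \<beta>) \<subseteq> sumset (supp \<alpha>) (supp \<beta>)"
proof
  fix g assume "g \<in> supp (\<alpha> \<otimes>\<^bsub>D\<^esub> \<beta>)"
  then have "(\<Sum>u\<in>{u \<in> supp \<alpha>. g - u \<in> supp \<beta>}. \<alpha> u * \<phi> u (\<beta> (g - u))) \<noteq> 0"
    using mult_coeff[OF wfp_on_supp[OF assms(1)] subset_refl wfp_on_supp[OF assms(2)] subset_refl]
    by (simp add: supp_def)
  then obtain u where "u \<in> supp \<alpha>" "g - u \<in> supp \<beta>"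
    by (metis (mono_tags, lifting) mem_Collect_eq sum.not_neutral_contains_not_neutral)
  from sumsetI[OF this] show "g \<in> sumset (supp \<alpha>) (supp \<beta>)" by simp
qed

lemma mult_closed:
  assumes "\<alpha> \<in> carrier D" "\<beta> \<in> carrier D"
  shows "\<alpha> \<otimes>\<^bsub>D\<^esub> \<beta> \<in> carrier D"
  unfolding carrier_iff
proof (intro conjI allI)
  show "(\<alpha> \<otimes>\<^bsub>D\<^esub> \<beta>) g \<in> K" for g
    unfolding mult_coeff[OF wfp_on_supp[OF assms(1)] subset_refl wfp_on_supp[OF assms(2)] subset_refl]
    using assms by (intro K_sum K_mult phi_closed) (auto simp: carrier_iff)
  show "wfp_on (supp (\<alpha> \<otimes>\<^bsub>D\<^esub> \<beta>)) (<)"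
    by (rule wfp_on_subset[OF wfp_on_sumset supp_mult]) (fact assms wfp_on_supp[OF assms(1)] wfp_on_supp[OF assms(2)])+
qed

lemma supp_add: "supp (\<alpha> \<oplus>\<^bsub>D\<^esub> \<beta>) \<subseteq> supp \<alpha> \<union> supp \<beta>"
  by (auto simp: supp_def add_eq)

lemma add_closed:
  assumes "\<alpha> \<in> carrier D" "\<beta> \<in> carrier D"
  shows "\<alpha> \<oplus>\<^bsub>D\<^esub> \<beta> \<in> carrier D"
proof -
  have "wfp_on (supp (\<alpha> \<oplus>\<^bsub>D\<^esub> \<beta>)) (<)"
    using wfp_on_subset[OF wfp_on_Un supp_add] assms by (simp add: carrier_iff)
  with assms show ?thesis by (simp add: carrier_iff add_eq K_add)
qed

lemma monomial_closed: "c \<in> K \<Longrightarrow> (\<lambda>g. if g = h then c else 0) \<in> carrier D"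
proof -
  assume "c \<in> K"
  have "wfp_on (supp (\<lambda>g. if g = h then c else 0)) (<)"
    by (rule wfp_on_subset[OF wfp_on_less_singleton[of h]]) (auto simp: supp_def)
  with \<open>c \<in> K\<close> show ?thesis by (simp add: carrier_iff K_zero)
qed

lemma single_term_closed: "single_term h \<in> carrier D"
  unfolding single_term_def by (rule monomial_closed[OF K_one])

lemma monomial_mult_coeff:
  assumes "\<beta> \<in> carrier D"
  shows "((\<lambda>g. if g = h then c else 0) \<otimes>\<^bsub>D\<^esub> \<beta>) g = c * \<phi> h (\<beta> (g - h))"
proof -
  have "{u \<in> {h}. g - u \<in> supp \<beta>} = (if g - h \<in> supp \<beta> then {h} else {})" by auto
  moreover have "supp (\<lambda>g. if g = h then c else 0) \<subseteq> {h}" by (auto simp: supp_def)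
  ultimately show ?thesis
    using mult_coeff[OF wfp_on_less_singleton _ wfp_on_supp[OF assms] subset_refl, of _ h g]
    by (simp add: supp_def phi_0)
qed

text \<open>
  Both sides sum \<open>\<alpha> u * \<phi> u (\<beta> v) * \<phi> (u + v) (\<gamma> t)\<close> over all \<open>u + v + t = g\<close>; the action law for \<open>u + v\<close>
  makes the twists agree.
\<close>

lemma mult_assoc:
  assumes "\<alpha> \<in> carrier D" "\<beta> \<in> carrier D" "\<gamma> \<in> carrier D"
  shows "(\<alpha> \<otimes>\<^bsub>D\<^esub> \<beta>) \<otimes>\<^bsub>D\<^esub> \<gamma> = \<alpha> \<otimes>\<^bsub>D\<^esub> (\<beta> \<otimes>\<^bsub>D\<^esub> \<gamma>)"
proof
  fix g
  let ?A = "supp \<alpha>" and ?B = "supp \<beta>" and ?C = "supp \<gamma>"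
  note wf = assms[THEN wfp_on_supp]
  let ?t = "\<lambda>u v. \<alpha> u * \<phi> u (\<beta> v) * \<phi> (u + v) (\<gamma> (g - u - v))"
  have "((\<alpha> \<otimes>\<^bsub>D\<^esub> \<beta>) \<otimes>\<^bsub>D\<^esub> \<gamma>) g =
      (\<Sum>w\<in>{w \<in> sumset ?A ?B. g - w \<in> ?C}. \<Sum>u\<in>{u \<in> ?A. w - u \<in> ?B}. ?t u (w - u))"
    unfolding mult_coeff[OF wfp_on_sumset[OF wf(1,2)] supp_mult[OF assms(1,2)] wf(3) subset_refl]
      mult_coeff[OF wf(1) subset_refl wf(2) subset_refl]
    by (simp add: sum_distrib_right)
  also have "\<dots> = (\<Sum>(w, u)\<in>(SIGMA w:{w \<in> sumset ?A ?B. g - w \<in> ?C}. {u \<in> ?A. w - u \<in> ?B}).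
      ?t u (w - u))"
    by (intro sum.Sigma ballI finite_sumset_fibre[OF wfp_on_sumset[OF wf(1,2)] wf(3)]
        finite_sumset_fibre[OF wf(1,2)])
  also have "\<dots> = (\<Sum>(u, v)\<in>(SIGMA u:{u \<in> ?A. g - u \<in> sumset ?B ?C}. {v \<in> ?B. g - u - v \<in> ?C}).
      ?t u v)"
  proof (rule sum.reindex_bij_witness[where i = "\<lambda>(u, v). (u + v, u)" and j = "\<lambda>(w, u). (u, w - u)"])
    fix x assume "x \<in> (SIGMA w:{w \<in> sumset ?A ?B. g - w \<in> ?C}. {u \<in> ?A. w - u \<in> ?B})"
    then obtain w u where x: "x = (w, u)" "u \<in> ?A" "w - u \<in> ?B" "g - w \<in> ?C" by blast
    from sumsetI[OF x(3,4)] x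
    show "(case x of (w, u) \<Rightarrow> (u, w - u)) \<in>
        (SIGMA u:{u \<in> ?A. g - u \<in> sumset ?B ?C}. {v \<in> ?B. g - u - v \<in> ?C})" by simp
  next
    fix x assume "x \<in> (SIGMA u:{u \<in> ?A. g - u \<in> sumset ?B ?C}. {v \<in> ?B. g - u - v \<in> ?C})"
    then obtain u v where x: "x = (u, v)" "u \<in> ?A" "v \<in> ?B" "g - u - v \<in> ?C" by blast
    from sumsetI[OF x(2,3)] x
    show "(case x of (u, v) \<Rightarrow> (u + v, u)) \<in>
        (SIGMA w:{w \<in> sumset ?A ?B. g - w \<in> ?C}. {u \<in> ?A. w - u \<in> ?B})"
      by (simp add: diff_diff_eq)
  qed auto
  also have "\<dots> = (\<Sum>u\<in>{u \<in> ?A. g - u \<in> sumset ?B ?C}. \<Sum>v\<in>{v \<in> ?B. g - u - v \<in> ?C}. ?t u v)"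
    by (intro sum.Sigma[symmetric] ballI finite_sumset_fibre[OF wf(1) wfp_on_sumset[OF wf(2,3)]]
        finite_sumset_fibre[OF wf(2,3)])
  also have "\<dots> = (\<alpha> \<otimes>\<^bsub>D\<^esub> (\<beta> \<otimes>\<^bsub>D\<^esub> \<gamma>)) g"
    unfolding mult_coeff[OF wf(1) subset_refl wfp_on_sumset[OF wf(2,3)] supp_mult[OF assms(2,3)]]
      mult_coeff[OF wf(2) subset_refl wf(3) subset_refl]
    using assms[THEN coeff_in_K]
    by (intro sum.cong refl)
      (simp add: phi_sum K_mult phi_closed phi_mult phi_plus_exp sum_distrib_left mult.assoc)
  finally show "((\<alpha> \<otimes>\<^bsub>D\<^esub> \<beta>) \<otimes>\<^bsub>D\<^esub> \<gamma>) g = (\<alpha> \<otimes>\<^bsub>D\<^esub> (\<beta> \<otimes>\<^bsub>D\<^esub> \<gamma>)) g" .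
qed

lemma add_distrib:
  assumes "\<alpha> \<in> carrier D" "\<beta> \<in> carrier D" "\<gamma> \<in> carrier D"
  shows "(\<alpha> \<oplus>\<^bsub>D\<^esub> \<beta>) \<otimes>\<^bsub>D\<^esub> \<gamma> = \<alpha> \<otimes>\<^bsub>D\<^esub> \<gamma> \<oplus>\<^bsub>D\<^esub> \<beta> \<otimes>\<^bsub>D\<^esub> \<gamma>"
    and "\<gamma> \<otimes>\<^bsub>D\<^esub> (\<alpha> \<oplus>\<^bsub>D\<^esub> \<beta>) = \<gamma> \<otimes>\<^bsub>D\<^esub> \<alpha> \<oplus>\<^bsub>D\<^esub> \<gamma> \<otimes>\<^bsub>D\<^esub> \<beta>"
proof -
  let ?S = "supp \<alpha> \<union> supp \<beta>"
  note wf = assms[THEN wfp_on_supp]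
  note S = wfp_on_Un[OF wf(1,2)]
  note ab = assms(1,2)[THEN coeff_in_K]
  show "(\<alpha> \<oplus>\<^bsub>D\<^esub> \<beta>) \<otimes>\<^bsub>D\<^esub> \<gamma> = \<alpha> \<otimes>\<^bsub>D\<^esub> \<gamma> \<oplus>\<^bsub>D\<^esub> \<beta> \<otimes>\<^bsub>D\<^esub> \<gamma>"
    unfolding add_eq[of "_ \<otimes>\<^bsub>D\<^esub> _"] fun_eq_iff mult_coeff[OF S supp_add wf(3) subset_refl]
      mult_coeff[OF S Un_upper1 wf(3) subset_refl] mult_coeff[OF S Un_upper2 wf(3) subset_refl]
    by (simp add: add_eq distrib_right sum.distrib)
  show "\<gamma> \<otimes>\<^bsub>D\<^esub> (\<alpha> \<oplus>\<^bsub>D\<^esub> \<beta>) = \<gamma> \<otimes>\<^bsub>D\<^esub> \<alpha> \<oplus>\<^bsub>D\<^esub> \<gamma> \<otimes>\<^bsub>D\<^esub> \<beta>"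
    unfolding add_eq[of "_ \<otimes>\<^bsub>D\<^esub> _"] fun_eq_iff mult_coeff[OF wf(3) subset_refl S supp_add]
      mult_coeff[OF wf(3) subset_refl S Un_upper1] mult_coeff[OF wf(3) subset_refl S Un_upper2]
    by (simp add: add_eq phi_add ab distrib_left sum.distrib)
qed

lemma one_mult: "\<alpha> \<in> carrier D \<Longrightarrow> \<one>\<^bsub>D\<^esub> \<otimes>\<^bsub>D\<^esub> \<alpha> = \<alpha>"
  unfolding one_eq single_term_def
  by (simp add: fun_eq_iff monomial_mult_coeff phi_zero_exp coeff_in_K)

lemma mult_one:
  assumes "\<alpha> \<in> carrier D"
  shows "\<alpha> \<otimes>\<^bsub>D\<^esub> \<one>\<^bsub>D\<^esub> = \<alpha>"
proof
  fix g
  have "{u \<in> supp \<alpha>. g - u \<in> {0}} = (if g \<in> supp \<alpha> then {g} else {})" by auto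
  moreover have "supp \<one>\<^bsub>D\<^esub> \<subseteq> {0}" by (auto simp: supp_def one_eq single_term_def)
  ultimately show "(\<alpha> \<otimes>\<^bsub>D\<^esub> \<one>\<^bsub>D\<^esub>) g = \<alpha> g"
    using mult_coeff[OF wfp_on_supp[OF assms] subset_refl wfp_on_less_singleton, of _ 0 g]
    by (simp add: supp_def one_eq single_term_def phi_1)
qed

lemma uminus_closed: "\<alpha> \<in> carrier D \<Longrightarrow> (\<lambda>g. - \<alpha> g) \<in> carrier D"
  by (simp add: carrier_iff K_uminus supp_def)

lemma ring_D: "ring D"
proof (rule ringI)
  show "abelian_group D"
  proof (rule abelian_groupI)
    show "\<zero>\<^bsub>D\<^esub> \<in> carrier D" using monomial_closed[OF K_zero] by (simp add: zero_eq)
    show "\<exists>y\<in>carrier D. y \<oplus>\<^bsub>D\<^esub> x = \<zero>\<^bsub>D\<^esub>" if "x \<in> carrier D" for x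
      using uminus_closed[OF that] by (rule rev_bexI) (simp add: add_eq zero_eq)
  qed (simp_all add: add_closed, simp_all add: add_eq zero_eq add_ac)
  show "Group.monoid D"
    by (rule monoidI)
      (simp_all add: mult_closed mult_assoc one_mult mult_one, simp add: one_eq single_term_closed)
qed (simp_all add: add_distrib)

sublocale ring D by (rule ring_D)

lemma a_inv_eq: "\<alpha> \<in> carrier D \<Longrightarrow> \<ominus>\<^bsub>D\<^esub> \<alpha> = (\<lambda>g. - \<alpha> g)"
  by (rule minus_equality) (simp_all add: uminus_closed add_eq zero_eq)

lemma val_in_supp:
  assumes "\<alpha> \<in> carrier D" "\<alpha> \<noteq> \<zero>\<^bsub>D\<^esub>"
  shows "val \<alpha> \<in> supp \<alpha>" and "g \<in> supp \<alpha> \<Longrightarrow> val \<alpha> \<le> g"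
proof -
  have "supp \<alpha> \<noteq> {}" using assms(2) by (auto simp: supp_def zero_eq)
  then obtain m where m: "m \<in> supp \<alpha>" "\<And>x. x \<in> supp \<alpha> \<Longrightarrow> m \<le> x"
    using wfp_on_less_least[OF wfp_on_supp[OF assms(1)] subset_refl] by blast
  then have "val \<alpha> = m" unfolding val_def by (rule Least_equality)
  with m show "val \<alpha> \<in> supp \<alpha>" "g \<in> supp \<alpha> \<Longrightarrow> val \<alpha> \<le> g" by auto
qed

lemma val_eqI: "m \<in> supp \<alpha> \<Longrightarrow> (\<And>x. x \<in> supp \<alpha> \<Longrightarrow> m \<le> x) \<Longrightarrow> val \<alpha> = m"
  unfolding val_def by (rule Least_equality)

text \<open>The two lowest terms contribute the only term of the product in degree \<open>val \<alpha> + val \<beta>\<close>.\<close>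

lemma val_mult:
  assumes "\<alpha> \<in> carrier D" "\<alpha> \<noteq> \<zero>\<^bsub>D\<^esub>" "\<beta> \<in> carrier D" "\<beta> \<noteq> \<zero>\<^bsub>D\<^esub>"
  shows "\<alpha> \<otimes>\<^bsub>D\<^esub> \<beta> \<noteq> \<zero>\<^bsub>D\<^esub>" and "val (\<alpha> \<otimes>\<^bsub>D\<^esub> \<beta>) = val \<alpha> + val \<beta>"
proof -
  let ?a = "val \<alpha>" and ?b = "val \<beta>"
  note a = val_in_supp[OF assms(1,2)] and b = val_in_supp[OF assms(3,4)]
  have "{u \<in> supp \<alpha>. ?a + ?b - u \<in> supp \<beta>} = {?a}"
  proof (intro equalityI subsetI)
    fix u assume "u \<in> {u \<in> supp \<alpha>. ?a + ?b - u \<in> supp \<beta>}"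
    then have "?a \<le> u" "?b \<le> ?a + ?b - u" using a b by auto
    then have "u = ?a" by (simp add: le_diff_eq)
    then show "u \<in> {?a}" by simp
  qed (use a b in auto)
  then have "(\<alpha> \<otimes>\<^bsub>D\<^esub> \<beta>) (?a + ?b) = \<alpha> ?a * \<phi> ?a (\<beta> ?b)"
    using mult_coeff[OF wfp_on_supp[OF assms(1)] subset_refl wfp_on_supp[OF assms(3)] subset_refl]
    by simp
  then have in_supp: "?a + ?b \<in> supp (\<alpha> \<otimes>\<^bsub>D\<^esub> \<beta>)"
    using a(1) b(1) coeff_in_K[OF assms(3)] by (simp add: supp_def phi_eq_0_iff)
  then show "\<alpha> \<otimes>\<^bsub>D\<^esub> \<beta> \<noteq> \<zero>\<^bsub>D\<^esub>" by (auto simp: supp_def zero_eq)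
  show "val (\<alpha> \<otimes>\<^bsub>D\<^esub> \<beta>) = ?a + ?b"
  proof (rule val_eqI[OF in_supp])
    fix g assume "g \<in> supp (\<alpha> \<otimes>\<^bsub>D\<^esub> \<beta>)"
    then obtain u v where "g = u + v" "u \<in> supp \<alpha>" "v \<in> supp \<beta>"
      using supp_mult[OF assms(1,3)] unfolding sumset_def by blast
    then show "?a + ?b \<le> g" using a(2) b(2) by (simp add: add_mono)
  qed
qed

lemma val_add:
  assumes "\<alpha> \<in> carrier D" "\<alpha> \<noteq> \<zero>\<^bsub>D\<^esub>" "\<beta> \<in> carrier D" "\<beta> \<noteq> \<zero>\<^bsub>D\<^esub>" "\<alpha> \<oplus>\<^bsub>D\<^esub> \<beta> \<noteq> \<zero>\<^bsub>D\<^esub>"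
  shows "min (val \<alpha>) (val \<beta>) \<le> val (\<alpha> \<oplus>\<^bsub>D\<^esub> \<beta>)"
  using val_in_supp(1)[OF add_closed[OF assms(1,3)] assms(5)] supp_add[of \<alpha> \<beta>]
    val_in_supp(2)[OF assms(1,2)] val_in_supp(2)[OF assms(3,4)] by (auto simp: min_le_iff_disj)

lemma val_monomial: "c \<noteq> 0 \<Longrightarrow> val (\<lambda>g. if g = h then c else 0) = h"
  by (rule val_eqI) (auto simp: supp_def split: if_splits)

lemma val_one: "val \<one>\<^bsub>D\<^esub> = 0"
  unfolding one_eq single_term_def by (rule val_monomial) simp

lemma one_not_zero_D: "\<one>\<^bsub>D\<^esub> \<noteq> \<zero>\<^bsub>D\<^esub>"
  by (auto simp: one_eq zero_eq single_term_def fun_eq_iff)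

text \<open>
  Comparing coefficients in \<open>\<alpha> \<beta> = 1\<close> gives a recursion: the term of \<open>\<alpha>\<close> of lowest degree \<open>m\<close>
  determines \<open>\<beta> h\<close> from the values of \<open>\<beta>\<close> below \<open>h\<close>. It is well-founded once \<open>\<beta>\<close> is required to
  vanish outside the translate by \<open>- m\<close> of the monoid generated by \<open>{u - m | u \<in> supp \<alpha>, u > m}\<close>,
  which is well-ordered by Neumann's lemma. For degrees outside the monoid the
  coefficient equations are trivial, since no term contributes to them.
\<close>

lemma right_inverse:
  assumes \<alpha>: "\<alpha> \<in> carrier D" "\<alpha> \<noteq> \<zero>\<^bsub>D\<^esub>"
  shows "\<exists>\<beta>\<in>carrier D. \<alpha> \<otimes>\<^bsub>D\<^esub> \<beta> = \<one>\<^bsub>D\<^esub>"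
proof -
  define m where "m = val \<alpha>"
  note val = val_in_supp[OF \<alpha>, folded m_def]
  have am: "\<alpha> m \<noteq> 0" using val(1) by (simp add: supp_def)
  define P where "P = {d. 0 < d \<and> m + d \<in> supp \<alpha>}"
  define S where "S = sum_list ` lists P"
  define T where "T = {h. m + h \<in> S}"
  have zero_S: "0 \<in> S" unfolding S_def by (rule image_eqI[of _ _ "[]"]) auto
  have step_S: "d + s \<in> S" if "d \<in> P" "s \<in> S" for d s
  proof -
    from that(2) obtain w where "w \<in> lists P" "s = sum_list w" unfolding S_def by blast
    with that(1) show ?thesis unfolding S_def by (intro image_eqI[of _ _ "d # w"]) auto
  qed
  have "wfp_on P (<)"
    by (rule wfp_on_subset[OF wfp_on_translate[OF wfp_on_supp[OF \<alpha>(1)]]]) (auto simp: P_def)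
  then have "wfp_on S (<)" unfolding S_def by (rule wfp_on_sums_nonneg) (auto simp: P_def)
  then have T: "wfp_on T (<)" unfolding T_def by (rule wfp_on_translate)
  define R where "R = {(x, y). x < y \<and> x \<in> T \<and> y \<in> T}"
  have R: "wf R" using T unfolding wfp_on_less_iff_wf R_def .
  \<comment> \<open>\<open>rhs f h\<close> is what the lowest term of \<open>\<alpha>\<close> has to contribute in degree \<open>m + h\<close> if \<open>f\<close> is the inverse\<close>
  define rhs where "rhs f h = \<one>\<^bsub>D\<^esub> (m + h) -
      (\<Sum>u\<in>{u \<in> supp \<alpha> - {m}. m + h - u \<in> T}. \<alpha> u * \<phi> u (f (m + h - u)))" for f h
  define F where "F f h = (if h \<in> T then \<phi> (- m) (inverse (\<alpha> m) * rhs f h) else 0)" for f h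
  define \<beta> where "\<beta> = wfrec R F"
  have rec: "\<beta> h = \<phi> (- m) (inverse (\<alpha> m) * rhs \<beta> h)" if "h \<in> T" for h
  proof -
    have "(m + h - u, h) \<in> R" if "u \<in> supp \<alpha> - {m}" "m + h - u \<in> T" for u
    proof -
      have "m < u" using that(1) val(2)[of u] by auto
      with that \<open>h \<in> T\<close> show ?thesis unfolding R_def by (simp add: diff_less_eq add.commute)
    qed
    then have "rhs (cut \<beta> R h) h = rhs \<beta> h"
      unfolding rhs_def by (intro arg_cong2[of _ _ _ _ "(-)"] sum.cong) (auto simp: cut_apply)
    with that show ?thesis
      using wfrec[OF R, of F h] unfolding \<beta>_def[symmetric] by (simp add: F_def)
  qed
  have beta_0: "\<beta> h = 0" if "h \<notin> T" for h
    using wfrec[OF R, of F h] that unfolding \<beta>_def[symmetric] by (simp add: F_def)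
  have rhs_K: "rhs \<beta> h \<in> K" if "\<And>x. x < h \<Longrightarrow> x \<in> T \<Longrightarrow> \<beta> x \<in> K" for h
    unfolding rhs_def
  proof (intro K_diff K_sum K_mult phi_closed coeff_in_K[OF \<alpha>(1)])
    show "\<one>\<^bsub>D\<^esub> (m + h) \<in> K" by (rule coeff_in_K) simp
    fix u assume u: "u \<in> {u \<in> supp \<alpha> - {m}. m + h - u \<in> T}"
    then have "m < u" using val(2)[of u] by auto
    with u show "\<beta> (m + h - u) \<in> K" by (intro that) (simp_all add: diff_less_eq add.commute)
  qed
  have beta_K: "\<beta> h \<in> K" for h
  proof (cases "h \<in> T")
    case True
    from T show ?thesis
    proof (induction h rule: wfp_on_induct)
      case in_set
      show ?case by (rule True)
    next
      case (less h)
      then have "rhs \<beta> h \<in> K" by (intro rhs_K) auto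
      with less.hyps show ?case
        by (simp add: rec phi_closed K_mult K_inverse coeff_in_K[OF \<alpha>(1)])
    qed
  qed (simp add: beta_0 K_zero)
  have supp_beta: "supp \<beta> \<subseteq> T" using beta_0 by (auto simp: supp_def)
  have beta: "\<beta> \<in> carrier D"
    using beta_K wfp_on_subset[OF T supp_beta] by (simp add: carrier_iff)
  have "(\<alpha> \<otimes>\<^bsub>D\<^esub> \<beta>) g = \<one>\<^bsub>D\<^esub> g" for g
  proof -
    let ?I = "{u \<in> supp \<alpha>. g - u \<in> T}"
    have coeff: "(\<alpha> \<otimes>\<^bsub>D\<^esub> \<beta>) g = (\<Sum>u\<in>?I. \<alpha> u * \<phi> u (\<beta> (g - u)))"
      by (rule mult_coeff[OF wfp_on_supp[OF \<alpha>(1)] subset_refl T supp_beta])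
    show ?thesis
    proof (cases "g \<in> S")
      case True
      then have mI: "m \<in> ?I" and gT: "g - m \<in> T" using val(1) by (auto simp: T_def)
      have "\<alpha> m * \<phi> m (\<beta> (g - m)) = rhs \<beta> (g - m)"
        using am phi_inverse_exp(2) rhs_K[OF beta_K] rec[OF gT]
        by (simp add: K_mult K_inverse coeff_in_K[OF \<alpha>(1)])
      also have "\<dots> = \<one>\<^bsub>D\<^esub> g - (\<Sum>u\<in>?I - {m}. \<alpha> u * \<phi> u (\<beta> (g - u)))"
        unfolding rhs_def by (intro arg_cong2[of _ _ _ _ "(-)"] sum.cong) auto
      finally show ?thesis
        unfolding coeff
        using sum.remove[OF finite_sumset_fibre[OF wfp_on_supp[OF \<alpha>(1)] T] mI,
            of "\<lambda>u. \<alpha> u * \<phi> u (\<beta> (g - u))"] by simp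
    next
      case False
      have I: "?I = {}"
      proof (rule ccontr)
        assume "?I \<noteq> {}"
        then obtain u where u: "u \<in> supp \<alpha>" "m + (g - u) \<in> S" unfolding T_def by blast
        have "g \<in> S"
        proof (cases "u = m")
          case False
          with u(1) val(2)[of u] have "u - m \<in> P" by (simp add: P_def)
          from step_S[OF this u(2)] show ?thesis by simp
        qed (use u in simp)
        with False show False by blast
      qed
      have "g \<noteq> 0" using False zero_S by blast
      then show ?thesis unfolding coeff I by (simp add: one_eq single_term_def)
    qed
  qed
  with beta show ?thesis by (intro bexI[of _ \<beta>]) (simp_all add: fun_eq_iff)
qed

text \<open>
  Right inverses of all nonzero elements suffice: a right inverse of a right inverse of \<open>x\<close> is \<open>x\<close>
  itself.
\<close>

lemma group_mult_of: "group (Multiplicative_Group.mult_of D)"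
proof (rule groupI; simp)
  show "\<one>\<^bsub>D\<^esub> \<noteq> \<zero>\<^bsub>D\<^esub>" by (rule one_not_zero_D)
  have nonzero_right: "\<beta> \<noteq> \<zero>\<^bsub>D\<^esub>" if "\<alpha> \<in> carrier D" "\<alpha> \<otimes>\<^bsub>D\<^esub> \<beta> = \<one>\<^bsub>D\<^esub>" for \<alpha> \<beta>
    using that one_not_zero_D by auto
  fix x assume x: "x \<in> carrier D \<and> x \<noteq> \<zero>\<^bsub>D\<^esub>"
  show "x \<otimes>\<^bsub>D\<^esub> y \<noteq> \<zero>\<^bsub>D\<^esub>" if "y \<in> carrier D \<and> y \<noteq> \<zero>\<^bsub>D\<^esub>" for y
    using val_mult(1) x that by blast
  show "x \<otimes>\<^bsub>D\<^esub> y \<otimes>\<^bsub>D\<^esub> z = x \<otimes>\<^bsub>D\<^esub> (y \<otimes>\<^bsub>D\<^esub> z)"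
    if "y \<in> carrier D \<and> y \<noteq> \<zero>\<^bsub>D\<^esub>" "z \<in> carrier D \<and> z \<noteq> \<zero>\<^bsub>D\<^esub>" for y z
    using m_assoc x that by blast
  obtain y where y: "y \<in> carrier D" "x \<otimes>\<^bsub>D\<^esub> y = \<one>\<^bsub>D\<^esub>" using right_inverse x by blast
  then have y0: "y \<noteq> \<zero>\<^bsub>D\<^esub>" using nonzero_right x by blast
  obtain z where z: "z \<in> carrier D" "y \<otimes>\<^bsub>D\<^esub> z = \<one>\<^bsub>D\<^esub>" using right_inverse[OF y(1) y0] by blast
  have "z = x" using inv_unique[OF y(2) z(2)] x y z by simp
  with y y0 z show "\<exists>y\<in>carrier D - {\<zero>\<^bsub>D\<^esub>}. y \<otimes>\<^bsub>D\<^esub> x = \<one>\<^bsub>D\<^esub>" by blast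
qed

lemma Units_D: "Units D = carrier D - {\<zero>\<^bsub>D\<^esub>}"
proof (intro equalityI subsetI)
  fix x assume "x \<in> carrier D - {\<zero>\<^bsub>D\<^esub>}"
  then show "x \<in> Units D"
    using group.Units_eq[OF group_mult_of] unfolding Units_def by auto
next
  fix x assume "x \<in> Units D"
  then show "x \<in> carrier D - {\<zero>\<^bsub>D\<^esub>}" using one_not_zero_D unfolding Units_def by auto
qed

lemma val_inv:
  assumes "\<alpha> \<in> carrier D" "\<alpha> \<noteq> \<zero>\<^bsub>D\<^esub>"
  shows "val (inv\<^bsub>D\<^esub> \<alpha>) = - val \<alpha>"
proof -
  have u: "\<alpha> \<in> Units D" using assms by (simp add: Units_D)
  then have "inv\<^bsub>D\<^esub> \<alpha> \<in> Units D" by (rule Units_inv_Units)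
  with val_mult(2)[OF assms, of "inv\<^bsub>D\<^esub> \<alpha>"] show ?thesis
    using u by (simp add: Units_D val_one eq_neg_iff_add_eq_0 add.commute)
qed

lemma val_hom:
  fixes w :: "'g \<Rightarrow> int"
  assumes "\<And>g h. w (g + h) = w g + w h"
  shows "(\<lambda>\<alpha>. w (val \<alpha>)) \<in> hom (Multiplicative_Group.mult_of D) integer_group"
  using assms val_mult(2) by (intro homI) auto

text \<open>
  The group of exponents need not carry a multiplication by integers in its type, so the
  value of a power is read off through additive maps into the integers.
\<close>

lemma val_int_pow:
  fixes w :: "'g \<Rightarrow> int"
  assumes w: "\<And>g h. w (g + h) = w g + w h" and "\<alpha> \<in> carrier D" "\<alpha> \<noteq> \<zero>\<^bsub>D\<^esub>"
  shows "w (val (\<alpha> [^]\<^bsub>D\<^esub> (n::int))) = n * w (val \<alpha>)"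
proof -
  have w0: "w 0 = 0" using w[of 0 0] by simp
  have wm: "w (- g) = - w g" for g using w[of g "- g"] w0 by simp
  have nat: "\<alpha> [^]\<^bsub>D\<^esub> k \<in> carrier D - {\<zero>\<^bsub>D\<^esub>} \<and> w (val (\<alpha> [^]\<^bsub>D\<^esub> k)) = int k * w (val \<alpha>)" for k :: nat
  proof (induction k)
    case 0
    then show ?case using one_not_zero_D by (simp add: val_one w0)
  next
    case (Suc k)
    then show ?case using val_mult[of "\<alpha> [^]\<^bsub>D\<^esub> k" \<alpha>] assms by (simp add: w distrib_right)
  qed
  show ?thesis
  proof (cases "0 \<le> n")
    case True
    then show ?thesis using nat[of "nat n"] by (simp add: int_pow_def nat_pow_def)
  next
    case False
    then have "\<alpha> [^]\<^bsub>D\<^esub> n = inv\<^bsub>D\<^esub> (\<alpha> [^]\<^bsub>D\<^esub> nat (- n))" by (simp add: int_pow_def nat_pow_def)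
    with False show ?thesis using nat[of "nat (- n)"] by (simp add: val_inv wm)
  qed
qed

end

section \<open>Valuation rings of coarser valuations\<close>

text \<open>
  A monotone homomorphism \<open>w\<close> on the value group turns \<open>val\<close> into a coarser valuation, with values in
  the integers.
\<close>

locale coarsened_series = skew_series K \<phi>
  for K :: "'k::field set" and \<phi> :: "'g::linordered_ab_group_add \<Rightarrow> 'k \<Rightarrow> 'k" +
  fixes w :: "'g \<Rightarrow> int"
  assumes w_add: "w (g + h) = w g + w h"
    and w_mono: "g \<le> h \<Longrightarrow> w g \<le> w h"
begin

definition valuation_ring :: "('g \<Rightarrow> 'k) set" where
  "valuation_ring = {\<alpha> \<in> carrier D - {\<zero>\<^bsub>D\<^esub>}. 0 \<le> w (val \<alpha>)} \<union> {\<zero>\<^bsub>D\<^esub>}"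

lemma w_zero: "w 0 = 0"
  using w_add[of 0 0] by simp

lemma w_uminus: "w (- g) = - w g"
  using w_add[of g "- g"] w_zero by simp

lemma subring_valuation_ring: "subring valuation_ring D"
proof (rule subringI)
  show "valuation_ring \<subseteq> carrier D" by (auto simp: valuation_ring_def)
  show "\<one>\<^bsub>D\<^esub> \<in> valuation_ring" using one_not_zero_D by (simp add: valuation_ring_def val_one w_zero)
  fix a assume a: "a \<in> valuation_ring"
  then have aD: "a \<in> carrier D" by (auto simp: valuation_ring_def)
  have "supp (\<ominus>\<^bsub>D\<^esub> a) = supp a" by (simp add: a_inv_eq[OF aD] supp_def)
  then have "val (\<ominus>\<^bsub>D\<^esub> a) = val a" by (simp add: val_def)
  with a aD show "\<ominus>\<^bsub>D\<^esub> a \<in> valuation_ring" by (auto simp: valuation_ring_def)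
  fix b assume b: "b \<in> valuation_ring"
  then have bD: "b \<in> carrier D" by (auto simp: valuation_ring_def)
  show "a \<otimes>\<^bsub>D\<^esub> b \<in> valuation_ring"
    using a b aD bD val_mult[of a b] by (auto simp: valuation_ring_def w_add)
  show "a \<oplus>\<^bsub>D\<^esub> b \<in> valuation_ring"
  proof (cases "a = \<zero>\<^bsub>D\<^esub> \<or> b = \<zero>\<^bsub>D\<^esub> \<or> a \<oplus>\<^bsub>D\<^esub> b = \<zero>\<^bsub>D\<^esub>")
    case True
    then show ?thesis using a b aD bD by (auto simp: valuation_ring_def)
  next
    case False
    then have "min (val a) (val b) \<le> val (a \<oplus>\<^bsub>D\<^esub> b)" using val_add aD bD by blast
    then have "w (min (val a) (val b)) \<le> w (val (a \<oplus>\<^bsub>D\<^esub> b))" by (rule w_mono)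
    then show ?thesis using False a b aD bD by (auto simp: valuation_ring_def min_def split: if_splits)
  qed
qed

text \<open>A unit and its inverse both have non-negative value, and these values are opposite.\<close>

lemma Units_valuation_ring_eq_kernel:
  "Units (D\<lparr>carrier := valuation_ring\<rparr>) =
     kernel (Multiplicative_Group.mult_of D) integer_group (\<lambda>\<alpha>. w (val \<alpha>))"
proof (intro equalityI subsetI)
  fix x assume "x \<in> Units (D\<lparr>carrier := valuation_ring\<rparr>)"
  then obtain y where x: "x \<in> valuation_ring" and y: "y \<in> valuation_ring" "x \<otimes>\<^bsub>D\<^esub> y = \<one>\<^bsub>D\<^esub>" unfolding Units_def by auto
  have D: "x \<in> carrier D" "y \<in> carrier D" using x y by (auto simp: valuation_ring_def)
  then have "x \<noteq> \<zero>\<^bsub>D\<^esub>" "y \<noteq> \<zero>\<^bsub>D\<^esub>" using y(2) one_not_zero_D by auto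
  moreover from this have "val x + val y = 0" using val_mult(2)[of x y] D y(2) val_one by simp
  then have "w (val x) + w (val y) = 0" by (metis w_add w_zero)
  ultimately show "x \<in> kernel (Multiplicative_Group.mult_of D) integer_group (\<lambda>\<alpha>. w (val \<alpha>))"
    using x y D by (auto simp: kernel_def valuation_ring_def)
next
  fix x assume "x \<in> kernel (Multiplicative_Group.mult_of D) integer_group (\<lambda>\<alpha>. w (val \<alpha>))"
  then have x: "x \<in> carrier D" "x \<noteq> \<zero>\<^bsub>D\<^esub>" "w (val x) = 0" by (auto simp: kernel_def)
  then have u: "x \<in> Units D" by (simp add: Units_D)
  then have "inv\<^bsub>D\<^esub> x \<in> Units D" by (rule Units_inv_Units)
  then have "inv\<^bsub>D\<^esub> x \<in> valuation_ring" using x by (simp add: valuation_ring_def Units_D val_inv w_uminus)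
  moreover have "x \<in> valuation_ring" using x by (simp add: valuation_ring_def)
  ultimately show "x \<in> Units (D\<lparr>carrier := valuation_ring\<rparr>)"
    using Units_l_inv[OF u] Units_r_inv[OF u] unfolding Units_def by auto
qed

lemma normal_Units_valuation_ring: "Units (D\<lparr>carrier := valuation_ring\<rparr>) \<lhd> Multiplicative_Group.mult_of D"
proof -
  have "group_hom (Multiplicative_Group.mult_of D) integer_group (\<lambda>\<alpha>. w (val \<alpha>))"
    using val_hom[of w] w_add group_mult_of by (simp add: group_hom_def group_hom_axioms_def)
  then show ?thesis unfolding Units_valuation_ring_eq_kernel by (rule group_hom.normal_kernel)
qed

end

section \<open>Sign changes on a multiquadratic field\<close>

definition subfield_of_reals :: "real set \<Rightarrow> bool" where
  "subfield_of_reals F \<longleftrightarrow> 1 \<in> F \<and> (\<forall>a\<in>F. \<forall>b\<in>F. a - b \<in> F \<and> a * b \<in> F) \<and> (\<forall>a\<in>F. inverse a \<in> F)"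

lemma subfield_of_realsD:
  assumes "subfield_of_reals F"
  shows "1 \<in> F" "0 \<in> F" "a \<in> F \<Longrightarrow> b \<in> F \<Longrightarrow> a - b \<in> F" "a \<in> F \<Longrightarrow> b \<in> F \<Longrightarrow> a * b \<in> F"
    "a \<in> F \<Longrightarrow> inverse a \<in> F" "a \<in> F \<Longrightarrow> - a \<in> F" "a \<in> F \<Longrightarrow> b \<in> F \<Longrightarrow> a + b \<in> F"
    "a \<in> F \<Longrightarrow> b \<in> F \<Longrightarrow> a / b \<in> F"
proof -
  show *: "1 \<in> F" "a \<in> F \<Longrightarrow> b \<in> F \<Longrightarrow> a - b \<in> F" "a \<in> F \<Longrightarrow> b \<in> F \<Longrightarrow> a * b \<in> F"
    "a \<in> F \<Longrightarrow> inverse a \<in> F" for a b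
    using assms by (auto simp: subfield_of_reals_def)
  show 0: "0 \<in> F" using *(2)[OF *(1) *(1)] by simp
  show m: "a \<in> F \<Longrightarrow> - a \<in> F" for a using *(2)[OF 0] by simp
  show "a \<in> F \<Longrightarrow> b \<in> F \<Longrightarrow> a + b \<in> F" using *(2)[OF _ m, of a b] by simp
  show "a \<in> F \<Longrightarrow> b \<in> F \<Longrightarrow> a / b \<in> F" using *(3)[OF _ *(4), of a b] by (simp add: divide_inverse)
qed

definition adjoin :: "real set \<Rightarrow> real \<Rightarrow> real set" where
  "adjoin F d = {a + b * d | a b. a \<in> F \<and> b \<in> F}"

lemma adjoinI: "a \<in> F \<Longrightarrow> b \<in> F \<Longrightarrow> a + b * d \<in> adjoin F d"
  unfolding adjoin_def by blast

lemma subset_adjoin: "subfield_of_reals F \<Longrightarrow> F \<subseteq> adjoin F d"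
  using adjoinI[of _ F 0 d] subfield_of_realsD(2) by auto

lemma subfield_adjoin:
  assumes F: "subfield_of_reals F" and d: "d * d \<in> F"
  shows "subfield_of_reals (adjoin F d)"
proof -
  note F_rules = subfield_of_realsD[OF F]
  have diff_mult: "x - y \<in> adjoin F d \<and> x * y \<in> adjoin F d"
    if xy: "x \<in> adjoin F d" "y \<in> adjoin F d" for x y
  proof -
    from xy obtain a b a' b' where e: "a \<in> F" "b \<in> F" "a' \<in> F" "b' \<in> F"
      "x = a + b * d" "y = a' + b' * d"
      unfolding adjoin_def by blast
    have diff: "x - y = (a - a') + (b - b') * d" using e by (simp add: algebra_simps)
    have prod: "x * y = (a * a' + b * b' * (d * d)) + (a * b' + b * a') * d"
      using e by (simp add: algebra_simps)
    show ?thesis unfolding diff prod by (rule conjI adjoinI e(1-4) d F_rules)+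
  qed
  have inv: "inverse x \<in> adjoin F d" if "x \<in> adjoin F d" for x
  proof -
    from that obtain a b where e: "a \<in> F" "b \<in> F" "x = a + b * d" unfolding adjoin_def by blast
    define N where "N = a * a - b * b * (d * d)"
    have N: "N = x * (a - b * d)" using e by (simp add: N_def algebra_simps)
    have "N \<in> F" unfolding N_def using e d by (auto intro!: F_rules)
    show ?thesis
    proof (cases "N = 0")
      case True
      \<comment> \<open>the norm vanishes only if \<open>x = 0\<close> or the conjugate is \<open>0\<close>, and then \<open>x = 2 a\<close>\<close>
      then have "x = 0 \<or> x = a + a" using N e by auto
      then have "x \<in> F" using e by (auto intro: F_rules)
      then have "inverse x \<in> F" by (rule F_rules)
      then show ?thesis using subset_adjoin[OF F] by blast
    next
      case False
      then have "x \<noteq> 0" "a - b * d \<noteq> 0" using N by auto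
      then have "inverse x = (a - b * d) / N" unfolding N by (simp add: divide_inverse)
      also have "\<dots> = a / N + (- b / N) * d" by (simp add: diff_divide_distrib)
      also have "\<dots> \<in> adjoin F d" using e \<open>N \<in> F\<close> by (intro adjoinI) (auto intro!: F_rules)
      finally show ?thesis .
    qed
  qed
  have "1 \<in> adjoin F d" using subset_adjoin[OF F] F_rules by blast
  with diff_mult inv show ?thesis unfolding subfield_of_reals_def by blast
qed

text \<open>
  Square roots in a quadratic extension: if \<open>y = a + b d\<close> has its square in \<open>F\<close>, then the cross term
  \<open>2 a b d\<close> lies in \<open>F\<close>, so \<open>a b = 0\<close>.
\<close>

lemma sqrt_in_adjoin:
  assumes F: "subfield_of_reals F" and d: "d * d \<in> F" "d \<notin> F"
    and y: "y * y \<in> F" "y \<in> adjoin F d"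
  shows "y \<in> F \<or> y * d \<in> F"
proof -
  note F_rules = subfield_of_realsD[OF F]
  from y(2) obtain a b where e: "a \<in> F" "b \<in> F" "y = a + b * d" unfolding adjoin_def by blast
  have "a = 0 \<or> b = 0"
  proof (rule ccontr)
    assume "\<not> (a = 0 \<or> b = 0)"
    then have "d = (y * y - a * a - b * b * (d * d)) / (a * b + a * b)"
      using e(3) by (simp add: field_simps)
    also have "\<dots> \<in> F" by (rule e(1,2) y(1) d(1) F_rules)+
    finally show False using d(2) by simp
  qed
  moreover have "b * (d * d) \<in> F" using e(2) d(1) by (rule F_rules)
  ultimately show ?thesis using e by (auto simp: mult.assoc)
qed

definition rat_hom_on :: "real set \<Rightarrow> (real \<Rightarrow> real) \<Rightarrow> bool" where
  "rat_hom_on F \<sigma> \<longleftrightarrow> (\<forall>a\<in>F. \<forall>b\<in>F. \<sigma> (a + b) = \<sigma> a + \<sigma> b \<and> \<sigma> (a * b) = \<sigma> a * \<sigma> b) \<and> (\<forall>q\<in>\<rat>. \<sigma> q = q)"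

lemma rat_hom_on_subset: "rat_hom_on F \<sigma> \<Longrightarrow> E \<subseteq> F \<Longrightarrow> rat_hom_on E \<sigma>"
  unfolding rat_hom_on_def by blast

lemma rat_hom_on_id: "rat_hom_on F (\<lambda>z. z)"
  by (simp add: rat_hom_on_def)

text \<open>
  Since \<open>d\<close> is a root of \<open>X\<^sup>2 - d\<^sup>2\<close> with rational constant term, it may be sent to either root
  \<open>e * d\<close> of the same polynomial: \<open>a + b * d\<close> goes to \<open>\<sigma> a + e * \<sigma> b * d\<close>.
\<close>

lemma extend_rat_hom:
  assumes F: "subfield_of_reals F" and d: "d \<notin> F" "d * d \<in> \<rat>" "d * d \<in> F"
    and \<sigma>: "rat_hom_on F \<sigma>" "\<sigma> ` F \<subseteq> F" and rat: "\<rat> \<subseteq> F" and e: "e = 1 \<or> e = -1"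
  obtains \<tau> where "rat_hom_on (adjoin F d) \<tau>" "\<tau> ` adjoin F d \<subseteq> adjoin F d"
    "\<And>a. a \<in> F \<Longrightarrow> \<tau> a = \<sigma> a" "\<tau> d = e * d"
proof -
  note F_rules = subfield_of_realsD[OF F]
  have uniq: "a = a' \<and> b = b'"
    if "a \<in> F" "b \<in> F" "a' \<in> F" "b' \<in> F" "a + b * d = a' + b' * d" for a b a' b'
  proof -
    have "b = b'"
    proof (rule ccontr)
      assume "b \<noteq> b'"
      then have "d = (a' - a) / (b - b')" using that(5) by (simp add: field_simps)
      then show False using d(1) F_rules that(1-4) by metis
    qed
    with that(5) show ?thesis by simp
  qed
  define \<tau> where "\<tau> z = (THE y. \<exists>a\<in>F. \<exists>b\<in>F. z = a + b * d \<and> y = \<sigma> a + e * \<sigma> b * d)" for z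
  have \<tau>: "\<tau> (a + b * d) = \<sigma> a + e * \<sigma> b * d" if "a \<in> F" "b \<in> F" for a b
    unfolding \<tau>_def using that uniq by (intro the_equality) blast+
  have \<sigma>_add: "\<sigma> (a + b) = \<sigma> a + \<sigma> b" and \<sigma>_mult: "\<sigma> (a * b) = \<sigma> a * \<sigma> b"
    if "a \<in> F" "b \<in> F" for a b
    using \<sigma>(1) that unfolding rat_hom_on_def by blast+
  have \<sigma>_rat: "\<sigma> q = q" if "q \<in> \<rat>" for q using \<sigma>(1) that unfolding rat_hom_on_def by blast
  have ext: "\<tau> a = \<sigma> a" if "a \<in> F" for a
    using \<tau>[OF that F_rules(2)] \<sigma>_rat[of 0] by simp
  have "\<tau> (x + y) = \<tau> x + \<tau> y \<and> \<tau> (x * y) = \<tau> x * \<tau> y"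
    if xy: "x \<in> adjoin F d" "y \<in> adjoin F d" for x y
  proof -
    from xy obtain a b a' b' where E: "a \<in> F" "b \<in> F" "a' \<in> F" "b' \<in> F"
      and x: "x = a + b * d" and y: "y = a' + b' * d"
      unfolding adjoin_def by blast
    have sum: "x + y = (a + a') + (b + b') * d" by (simp add: x y algebra_simps)
    have prod: "x * y = (a * a' + b * b' * (d * d)) + (a * b' + b * a') * d"
      by (simp add: x y algebra_simps)
    have "\<tau> (x + y) = \<sigma> (a + a') + e * \<sigma> (b + b') * d"
      unfolding sum using E by (intro \<tau>) (auto intro!: F_rules)
    also have "\<dots> = \<tau> x + \<tau> y"
      using E by (simp add: x y \<tau> \<sigma>_add algebra_simps)
    finally have 1: "\<tau> (x + y) = \<tau> x + \<tau> y" .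
    have "\<tau> (x * y) = \<sigma> (a * a' + b * b' * (d * d)) + e * \<sigma> (a * b' + b * a') * d"
      unfolding prod using E d(3) by (intro \<tau>) (auto intro!: F_rules)
    also have "\<dots> = \<sigma> a * \<sigma> a' + \<sigma> b * \<sigma> b' * (d * d) + e * (\<sigma> a * \<sigma> b' + \<sigma> b * \<sigma> a') * d"
      using E d(3) by (simp add: \<sigma>_add \<sigma>_mult \<sigma>_rat[OF d(2)] F_rules)
    also have "\<dots> = \<tau> x * \<tau> y"
      using e by (auto simp: x y \<tau> E algebra_simps)
    finally show ?thesis using 1 by blast
  qed
  then have "rat_hom_on (adjoin F d) \<tau>"
    using rat ext \<sigma>_rat unfolding rat_hom_on_def by (metis subsetD)
  moreover have "\<tau> ` adjoin F d \<subseteq> adjoin F d"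
  proof
    fix z assume "z \<in> \<tau> ` adjoin F d"
    then obtain a b where E: "a \<in> F" "b \<in> F" "z = \<tau> (a + b * d)" unfolding adjoin_def by blast
    have "e \<in> F" using e F_rules by blast
    then have "e * \<sigma> b \<in> F" "\<sigma> a \<in> F" using \<sigma>(2) E F_rules by auto
    then show "z \<in> adjoin F d" unfolding E(3) \<tau>[OF E(1,2)] by (intro adjoinI)
  qed
  moreover have "\<tau> d = e * d"
    using \<tau>[OF F_rules(2) F_rules(1)] \<sigma>_rat[of 0] \<sigma>_rat[of 1] by simp
  ultimately show thesis using that ext by blast
qed

lemma subfield_Rats: "subfield_of_reals \<rat>"
  unfolding subfield_of_reals_def by (auto intro: Rats_diff Rats_mult Rats_inverse)

primrec tower :: "(nat \<Rightarrow> nat) \<Rightarrow> nat \<Rightarrow> real set" where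
  "tower p 0 = \<rat>"
| "tower p (Suc n) = adjoin (tower p n) (sqrt (real (p n)))"

lemma Rats_subset_tower: "\<rat> \<subseteq> tower p n" and subfield_tower: "subfield_of_reals (tower p n)"
proof (induction n)
  case (Suc n)
  {
    case 1
    show ?case using Suc subset_adjoin by fastforce
  next
    case 2
    have "real (p n) \<in> tower p n" using Suc(1) by auto
    then show ?case using subfield_adjoin[OF Suc(2)] by simp
  }
qed (simp_all add: subfield_Rats)

lemma tower_mono: "m \<le> n \<Longrightarrow> tower p m \<subseteq> tower p n"
  by (rule lift_Suc_mono_le) (simp_all add: subset_adjoin subfield_tower)

lemma common_tower:
  assumes "a \<in> (\<Union>n. tower p n)" "b \<in> (\<Union>n. tower p n)"
  obtains k where "a \<in> tower p k" "b \<in> tower p k"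
proof -
  from assms obtain m n where "a \<in> tower p m" "b \<in> tower p n" by blast
  then have "a \<in> tower p (max m n)" "b \<in> tower p (max m n)"
    using tower_mono[of m "max m n" p] tower_mono[of n "max m n" p] by auto
  then show thesis by (rule that)
qed

lemma sqrt_in_tower: "i < n \<Longrightarrow> sqrt (real (p i)) \<in> tower p n"
proof -
  assume "i < n"
  have "0 + 1 * sqrt (real (p i)) \<in> tower p (Suc i)"
    unfolding tower.simps by (intro adjoinI subfield_of_realsD[OF subfield_tower])
  with tower_mono[of "Suc i" n p] \<open>i < n\<close> show ?thesis by auto
qed

lemma real_ring_simps:
  "carrier (ring_of_type_algebra :: real ring) = UNIV"
  "\<zero>\<^bsub>(ring_of_type_algebra :: real ring)\<^esub> = 0"
  "\<one>\<^bsub>(ring_of_type_algebra :: real ring)\<^esub> = 1"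
  "a \<oplus>\<^bsub>(ring_of_type_algebra :: real ring)\<^esub> b = a + b"
  "a \<otimes>\<^bsub>(ring_of_type_algebra :: real ring)\<^esub> b = a * b"
  by (simp_all add: ring_of_type_algebra_def)

lemma real_ring_minus: "\<ominus>\<^bsub>(ring_of_type_algebra :: real ring)\<^esub> a = - a"
  using abelian_group.minus_equality[OF ring.is_abelian_group[OF ring_from_type_algebra],
      of "- a" a]
  unfolding real_ring_simps by simp

lemma real_ring_inverse:
  assumes "a \<noteq> 0"
  shows "inv\<^bsub>(ring_of_type_algebra :: real ring)\<^esub> a = inverse a"
  using comm_monoid.comm_inv_char[OF cring.axioms(2)[OF cring_from_type_algebra],
      of a "inverse a"] assms
  unfolding real_ring_simps by simp

lemma multiquadratic_field_eq_tower: "multiquadratic_field p = (\<Union>n. tower p n)"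
proof (intro equalityI subsetI)
  fix z assume "z \<in> multiquadratic_field p"
  then show "z \<in> (\<Union>n. tower p n)"
    unfolding multiquadratic_field_def
  proof induction
    case one
    then show ?case using subfield_of_realsD(1)[OF subfield_tower] by (auto simp: real_ring_simps)
  next
    case (incl h)
    then consider "h \<in> \<rat>" | i where "h = sqrt (real (p i))" by blast
    then show ?case
    proof cases
      case 1
      then have "h \<in> tower p 0" by simp
      then show ?thesis by blast
    next
      case 2
      then have "h \<in> tower p (Suc i)" using sqrt_in_tower[OF lessI] by simp
      then show ?thesis by blast
    qed
  next
    case (a_inv h)
    then show ?case using subfield_of_realsD(6)[OF subfield_tower]
      by (auto simp: real_ring_minus)
  next
    case (m_inv h)
    then show ?case using subfield_of_realsD(5)[OF subfield_tower]
      by (auto simp: real_ring_inverse real_ring_simps)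
  next
    case (eng_add h1 h2)
    then obtain k where "h1 \<in> tower p k" "h2 \<in> tower p k" using common_tower by blast
    then have "h1 + h2 \<in> tower p k" by (rule subfield_of_realsD[OF subfield_tower])
    then show ?case unfolding real_ring_simps by blast
  next
    case (eng_mult h1 h2)
    then obtain k where "h1 \<in> tower p k" "h2 \<in> tower p k" using common_tower by blast
    then have "h1 * h2 \<in> tower p k" by (rule subfield_of_realsD[OF subfield_tower])
    then show ?case unfolding real_ring_simps by blast
  qed
next
  fix z assume "z \<in> (\<Union>n. tower p n)"
  then obtain n where "z \<in> tower p n" by blast
  then show "z \<in> multiquadratic_field p"
  proof (induction n arbitrary: z)
    case 0
    then show ?case by (auto simp: multiquadratic_field_def intro: generate_field.incl)
  next
    case (Suc n)
    then obtain a b where "z = a + b * sqrt (real (p n))"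
      "a \<in> multiquadratic_field p" "b \<in> multiquadratic_field p"
      unfolding tower.simps adjoin_def by blast
    moreover have "sqrt (real (p n)) \<in> multiquadratic_field p"
      unfolding multiquadratic_field_def by (rule generate_field.incl) simp
    ultimately show ?case
      unfolding multiquadratic_field_def
      using generate_field.eng_add generate_field.eng_mult real_ring_simps(4,5) by metis
  qed
qed

lemma rat_hom_on_tower_unique:
  assumes "rat_hom_on (tower p n) \<sigma>" "rat_hom_on (tower p n) \<tau>"
    and "\<And>i. i < n \<Longrightarrow> \<sigma> (sqrt (real (p i))) = \<tau> (sqrt (real (p i)))"
    and "z \<in> tower p n"
  shows "\<sigma> z = \<tau> z"
  using assms
proof (induction n arbitrary: z)
  case 0
  then show ?case by (simp add: rat_hom_on_def)
next
  case (Suc n)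
  let ?s = "sqrt (real (p n))"
  have mono: "tower p n \<subseteq> tower p (Suc n)" by (rule tower_mono) simp
  have IH: "\<sigma> a = \<tau> a" if "a \<in> tower p n" for a
    using Suc.IH[OF rat_hom_on_subset[OF Suc.prems(1) mono] rat_hom_on_subset[OF Suc.prems(2) mono]]
      Suc.prems(3) that by simp
  from Suc.prems(4) obtain a b where z: "a \<in> tower p n" "b \<in> tower p n" "z = a + b * ?s"
    unfolding tower.simps adjoin_def by blast
  have s: "?s \<in> tower p (Suc n)" by (rule sqrt_in_tower) simp
  have ab: "a \<in> tower p (Suc n)" "b \<in> tower p (Suc n)" using z mono by auto
  have bs: "b * ?s \<in> tower p (Suc n)" using ab(2) s by (rule subfield_of_realsD[OF subfield_tower])
  have f: "f z = f a + f b * f ?s" if "rat_hom_on (tower p (Suc n)) f" for f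
    using that ab s bs unfolding rat_hom_on_def z(3) by simp
  show ?case
    unfolding f[OF Suc.prems(1)] f[OF Suc.prems(2)] IH[OF z(1)] IH[OF z(2)] Suc.prems(3)[OF lessI] ..
qed

lemma rat_hom_on_multiquadratic_unique:
  assumes "rat_hom_on (multiquadratic_field p) \<sigma>" "rat_hom_on (multiquadratic_field p) \<tau>"
    and "\<And>i. \<sigma> (sqrt (real (p i))) = \<tau> (sqrt (real (p i)))"
    and "z \<in> multiquadratic_field p"
  shows "\<sigma> z = \<tau> z"
proof -
  from assms(4) obtain n where n: "z \<in> tower p n" unfolding multiquadratic_field_eq_tower by blast
  have sub: "tower p n \<subseteq> multiquadratic_field p" unfolding multiquadratic_field_eq_tower by blast
  show ?thesis
    by (rule rat_hom_on_tower_unique[of p n \<sigma> \<tau>])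
      (rule rat_hom_on_subset[OF assms(1) sub] rat_hom_on_subset[OF assms(2) sub] assms(3) n)+
qed

lemma subfield_multiquadratic: "subfield_of_reals (multiquadratic_field p)"
proof -
  have "a - b \<in> (\<Union>n. tower p n) \<and> a * b \<in> (\<Union>n. tower p n)"
    if "a \<in> (\<Union>n. tower p n)" "b \<in> (\<Union>n. tower p n)" for a b
  proof -
    from that obtain k where "a \<in> tower p k" "b \<in> tower p k" by (rule common_tower)
    then have "a - b \<in> tower p k" "a * b \<in> tower p k"
      by (auto intro: subfield_of_realsD[OF subfield_tower])
    then show ?thesis by blast
  qed
  moreover have "inverse a \<in> (\<Union>n. tower p n)" if "a \<in> (\<Union>n. tower p n)" for a
    using that subfield_of_realsD(5)[OF subfield_tower] by blast
  moreover have "1 \<in> (\<Union>n. tower p n)" using subfield_of_realsD(1)[OF subfield_tower] by blast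
  ultimately show ?thesis unfolding subfield_of_reals_def multiquadratic_field_eq_tower by blast
qed

text \<open>Each prime \<open>p j\<close> with \<open>j \<in> S\<close> divides the product exactly once, but a square an even number of times.\<close>

lemma sqrt_prod_primes_irrational:
  assumes "inj p" "\<And>i. prime (p i :: nat)" "finite S" "S \<noteq> {}"
  shows "sqrt (real (\<Prod>i\<in>S. p i)) \<notin> \<rat>"
proof
  from assms(4) obtain j where j: "j \<in> S" by blast
  let ?m = "\<Prod>i\<in>S. p i" and ?q = "p j"
  have q: "prime ?q" by (rule assms(2))
  have m: "?m = ?q * (\<Prod>i\<in>S - {j}. p i)" using assms(3) j by (rule prod.remove)
  have not_dvd: "\<not> ?q dvd (\<Prod>i\<in>S - {j}. p i)"
  proof
    assume "?q dvd (\<Prod>i\<in>S - {j}. p i)"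
    then obtain i where "i \<in> S - {j}" "?q dvd p i"
      using assms(3) prime_dvd_prod_iff[OF _ q, of "S - {j}" p] by auto
    then show False using primes_dvd_imp_eq[OF q assms(2)] assms(1) by (metis DiffE injD singletonI)
  qed
  assume "sqrt (real ?m) \<in> \<rat>"
  then obtain a b :: nat where b: "b \<noteq> 0" and "\<bar>sqrt (real ?m)\<bar> = real a / real b"
    by (rule Rats_abs_nat_div_natE)
  then have "real ?m = (real a / real b)\<^sup>2" by (metis power2_abs real_sqrt_pow2 of_nat_0_le_iff)
  then have "real (?m * b\<^sup>2) = real (a\<^sup>2)" using b by (simp add: field_simps)
  then have eq: "?m * b\<^sup>2 = a\<^sup>2" by (simp only: of_nat_eq_iff)
  have m0: "?m \<noteq> 0" using assms(2,3) by (auto dest: prime_gt_0_nat)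
  have "?m * b\<^sup>2 \<noteq> 0" using m0 b by simp
  then have a: "a \<noteq> 0" unfolding eq by auto
  have "multiplicity ?q ?m = 1"
  proof -
    have "multiplicity ?q ?m = multiplicity ?q ?q + multiplicity ?q (\<Prod>i\<in>S - {j}. p i)"
      unfolding m using m0 q m by (intro prime_elem_multiplicity_mult_distrib) auto
    then show ?thesis using not_dvd q by (simp add: not_dvd_imp_multiplicity_0)
  qed
  moreover have "multiplicity ?q (?m * b\<^sup>2) = multiplicity ?q ?m + 2 * multiplicity ?q b"
    using m0 b q by (simp add: prime_elem_multiplicity_mult_distrib prime_elem_multiplicity_power_distrib)
  moreover have "multiplicity ?q (a\<^sup>2) = 2 * multiplicity ?q a"
    using a q by (simp add: prime_elem_multiplicity_power_distrib)
  ultimately have "1 + 2 * multiplicity ?q b = 2 * multiplicity ?q a" using eq by simp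
  then show False by presburger
qed

text \<open>
  The induction needs products: \<open>y = sqrt (\<Prod>i\<in>S. p i)\<close> in the next field of the tower would put \<open>y\<close>
  or \<open>y * sqrt (p n)\<close> into the present one, and the latter is the root for \<open>insert n S\<close>.
\<close>

lemma sqrt_prod_notin_tower:
  assumes "inj p" "\<And>i. prime (p i :: nat)" "finite S" "S \<noteq> {}" "S \<subseteq> {n..}"
  shows "sqrt (real (\<Prod>i\<in>S. p i)) \<notin> tower p n"
  using assms(3-5)
proof (induction n arbitrary: S)
  case 0
  then show ?case using sqrt_prod_primes_irrational[OF assms(1,2)] by simp
next
  case (Suc n)
  let ?d = "sqrt (real (p n))" and ?y = "sqrt (real (\<Prod>i\<in>S. p i))"
  have n: "n \<notin> S" "S \<subseteq> {n..}" using Suc.prems(3) by auto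
  have d: "?d \<notin> tower p n" using Suc.IH[of "{n}"] by simp
  have y: "?y \<notin> tower p n" using Suc.IH Suc.prems n by blast
  have "?y * ?d = sqrt (real (\<Prod>i\<in>insert n S. p i))"
    using Suc.prems(1) n by (simp add: real_sqrt_mult)
  also have "\<dots> \<notin> tower p n" using Suc.IH[of "insert n S"] Suc.prems n by auto
  finally have yd: "?y * ?d \<notin> tower p n" .
  have rat: "real k \<in> tower p n" for k by (rule subsetD[OF Rats_subset_tower]) simp
  have "?d * ?d \<in> tower p n" "?y * ?y \<in> tower p n" using rat by (simp_all del: of_nat_prod)
  with sqrt_in_adjoin[OF subfield_tower] d y yd show ?case unfolding tower.simps by blast
qed

lemma tower_hom_exists:
  assumes "inj p" "\<And>i. prime (p i :: nat)" "\<And>i. e i = 1 \<or> e i = (-1::real)"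
  shows "\<exists>\<sigma>. rat_hom_on (tower p n) \<sigma> \<and> \<sigma> ` tower p n \<subseteq> tower p n \<and>
    (\<forall>i<n. \<sigma> (sqrt (real (p i))) = e i * sqrt (real (p i)))"
proof (induction n)
  case 0
  show ?case by (rule exI[of _ id]) (simp add: rat_hom_on_def)
next
  case (Suc n)
  let ?d = "sqrt (real (p n))"
  from Suc obtain \<sigma> where \<sigma>: "rat_hom_on (tower p n) \<sigma>" "\<sigma> ` tower p n \<subseteq> tower p n"
    "\<And>i. i < n \<Longrightarrow> \<sigma> (sqrt (real (p i))) = e i * sqrt (real (p i))" by blast
  have d: "?d \<notin> tower p n" using sqrt_prod_notin_tower[OF assms(1,2), of "{n}" n] by simp
  have dd: "?d * ?d \<in> \<rat>" by simp
  then have dd': "?d * ?d \<in> tower p n" by (rule subsetD[OF Rats_subset_tower])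
  obtain \<tau> where \<tau>: "rat_hom_on (tower p (Suc n)) \<tau>" "\<tau> ` tower p (Suc n) \<subseteq> tower p (Suc n)"
    "\<And>a. a \<in> tower p n \<Longrightarrow> \<tau> a = \<sigma> a" "\<tau> ?d = e n * ?d"
    using extend_rat_hom[OF subfield_tower d dd dd' \<sigma>(1,2) Rats_subset_tower assms(3)]
    unfolding tower.simps by metis
  have "\<tau> (sqrt (real (p i))) = e i * sqrt (real (p i))" if "i < Suc n" for i
    using that \<tau>(3)[OF sqrt_in_tower] \<tau>(4) \<sigma>(3) by (cases "i = n") simp_all
  with \<tau>(1,2) show ?case by blast
qed

text \<open>
  The homomorphisms on the stages of the tower, chosen independently, are compatible by uniqueness;
  so each element may be mapped by the one belonging to the first stage containing it.
\<close>

lemma multiquadratic_hom_exists: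
  assumes "inj p" "\<And>i. prime (p i :: nat)" "\<And>i. e i = 1 \<or> e i = (-1::real)"
  obtains \<sigma> where "rat_hom_on (multiquadratic_field p) \<sigma>"
    "\<sigma> ` multiquadratic_field p \<subseteq> multiquadratic_field p"
    "\<And>i. \<sigma> (sqrt (real (p i))) = e i * sqrt (real (p i))"
proof -
  have "\<exists>s. \<forall>n. rat_hom_on (tower p n) (s n) \<and> s n ` tower p n \<subseteq> tower p n \<and>
      (\<forall>i<n. s n (sqrt (real (p i))) = e i * sqrt (real (p i)))"
    using tower_hom_exists[of p e, OF assms] by (intro choice) blast
  then obtain s where "\<forall>n. rat_hom_on (tower p n) (s n) \<and> s n ` tower p n \<subseteq> tower p n \<and>
      (\<forall>i<n. s n (sqrt (real (p i))) = e i * sqrt (real (p i)))" ..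
  then have s: "rat_hom_on (tower p n) (s n)" "s n ` tower p n \<subseteq> tower p n"
    "i < n \<Longrightarrow> s n (sqrt (real (p i))) = e i * sqrt (real (p i))" for n i
    by auto
  define N where "N z = (LEAST n. z \<in> tower p n)" for z
  have N: "z \<in> tower p (N z)" "N z \<le> n" if "z \<in> tower p n" for z n
    unfolding N_def using that by (auto intro: LeastI Least_le)
  define \<sigma> where "\<sigma> z = s (N z) z" for z
  have \<sigma>: "\<sigma> z = s n z" if z: "z \<in> tower p n" for z n
    unfolding \<sigma>_def
    using rat_hom_on_tower_unique[OF s(1) rat_hom_on_subset[OF s(1) tower_mono[OF N(2)[OF z]]] _ N(1)[OF z]]
      s(3) N(2)[OF z] by simp
  show thesis
  proof (rule that[of \<sigma>])
    have "\<sigma> (a + b) = \<sigma> a + \<sigma> b \<and> \<sigma> (a * b) = \<sigma> a * \<sigma> b"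
      if "a \<in> (\<Union>n. tower p n)" "b \<in> (\<Union>n. tower p n)" for a b
    proof -
      from that obtain k where ab: "a \<in> tower p k" "b \<in> tower p k" by (rule common_tower)
      then have "a + b \<in> tower p k" "a * b \<in> tower p k"
        using subfield_of_realsD(4,7)[OF subfield_tower] by blast+
      with ab s(1)[of k] show ?thesis by (simp add: \<sigma>[of _ k] rat_hom_on_def)
    qed
    moreover have "\<sigma> q = q" if "q \<in> \<rat>" for q
      using that \<sigma>[of q 0] s(1)[of 0] by (simp add: rat_hom_on_def)
    ultimately show "rat_hom_on (multiquadratic_field p) \<sigma>"
      unfolding rat_hom_on_def multiquadratic_field_eq_tower by blast
    show "\<sigma> ` multiquadratic_field p \<subseteq> multiquadratic_field p"
      unfolding multiquadratic_field_eq_tower using \<sigma> s(2) by fastforce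
    show "\<sigma> (sqrt (real (p i))) = e i * sqrt (real (p i))" for i
      using \<sigma>[OF sqrt_in_tower[OF lessI]] s(3)[OF lessI] by simp
  qed
qed

lemma Q_automorphism_iff:
  "Q_automorphism K \<sigma> \<longleftrightarrow> rat_hom_on K \<sigma> \<and> bij_betw \<sigma> K K"
  unfolding Q_automorphism_def rat_hom_on_def ring_iso_def ring_hom_def
  by (auto simp: real_ring_simps bij_betw_def)

lemma minus_one_powi: "(-1::real) powi k = (if even k then 1 else -1)"
  by (auto simp: power_int_def minus_one_power_iff even_nat_iff)

text \<open>A sign change is an involution, which makes it bijective.\<close>

lemma act_exists:
  assumes "inj p" "\<And>i. prime (p i :: nat)"
  shows "\<exists>\<sigma>. Q_automorphism (multiquadratic_field p) \<sigma> \<and>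
     (\<forall>i. \<sigma> (sqrt (real (p i))) = (-1) powi (Poly_Mapping.lookup g i) * sqrt (real (p i)))"
proof -
  let ?K = "multiquadratic_field p"
  define e where "e i = (-1::real) powi (Poly_Mapping.lookup g i)" for i
  have e: "e i = 1 \<or> e i = -1" for i unfolding e_def minus_one_powi by simp
  obtain \<sigma> where \<sigma>: "rat_hom_on ?K \<sigma>" "\<sigma> ` ?K \<subseteq> ?K"
    "\<And>i. \<sigma> (sqrt (real (p i))) = e i * sqrt (real (p i))"
    using multiquadratic_hom_exists[of p e, OF assms e] by blast
  have hom2: "rat_hom_on ?K (\<lambda>z. \<sigma> (\<sigma> z))"
    using \<sigma>(1,2) unfolding rat_hom_on_def image_subset_iff by simp
  have fixes_sqrt: "\<sigma> (\<sigma> (sqrt (real (p i)))) = sqrt (real (p i))" for i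
  proof -
    have "e i \<in> \<rat>" using e[of i] by auto
    moreover have "e i \<in> ?K" "sqrt (real (p i)) \<in> ?K"
      using calculation sqrt_in_tower[OF lessI] Rats_subset_tower
      unfolding multiquadratic_field_eq_tower by blast+
    ultimately have "\<sigma> (e i * sqrt (real (p i))) = e i * \<sigma> (sqrt (real (p i)))"
      using \<sigma>(1) unfolding rat_hom_on_def by metis
    then show ?thesis using e[of i] by (auto simp: \<sigma>(3))
  qed
  have involution: "\<sigma> (\<sigma> z) = z" if "z \<in> ?K" for z
    by (rule rat_hom_on_multiquadratic_unique[of p "\<lambda>z. \<sigma> (\<sigma> z)" "\<lambda>z. z", OF hom2 rat_hom_on_id fixes_sqrt that])
  have "bij_betw \<sigma> ?K ?K"
    using \<sigma>(2) involution by (intro bij_betw_byWitness[where f' = \<sigma>]) auto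
  with \<sigma> show ?thesis unfolding Q_automorphism_iff e_def by blast
qed

lemma act_spec:
  assumes "inj p" "\<And>i. prime (p i :: nat)"
  shows "rat_hom_on (multiquadratic_field p) (act p g)"
    and "a \<in> multiquadratic_field p \<Longrightarrow> act p g a \<in> multiquadratic_field p"
    and "act p g (sqrt (real (p i))) = (-1) powi (Poly_Mapping.lookup g i) * sqrt (real (p i))"
  using someI_ex[OF act_exists[OF assms, of g]]
  unfolding act_def Q_automorphism_iff by (auto simp: bij_betw_def)

lemma sqrt_in_multiquadratic: "sqrt (real (p i)) \<in> multiquadratic_field p"
  using sqrt_in_tower[OF lessI] unfolding multiquadratic_field_eq_tower by blast

lemma Rats_subset_multiquadratic: "\<rat> \<subseteq> multiquadratic_field p"
  using Rats_subset_tower unfolding multiquadratic_field_eq_tower by blast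

section \<open>The valuation ring of the first coordinate\<close>

lemma lookup_mono_0:
  fixes g h :: G
  assumes "g \<le> h"
  shows "Poly_Mapping.lookup g 0 \<le> Poly_Mapping.lookup h 0"
proof (cases "g = h")
  case False
  with assms have "g < h" by simp
  then have "less_fun (Poly_Mapping.lookup g) (Poly_Mapping.lookup h)"
    by (simp add: less_poly_mapping.rep_eq)
  then obtain k where "Poly_Mapping.lookup g k < Poly_Mapping.lookup h k"
    "\<And>k'. k' < k \<Longrightarrow> Poly_Mapping.lookup g k' = Poly_Mapping.lookup h k'" by (auto elim: less_funE)
  then show ?thesis by (cases "k = 0") auto
qed simp

lemma coarsened_series_MN:
  assumes "inj p" "\<And>i. prime (p i :: nat)"
  shows "coarsened_series (multiquadratic_field p) (act p) (\<lambda>g. Poly_Mapping.lookup g 0)"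
proof -
  let ?K = "multiquadratic_field p"
  note K = subfield_of_realsD[OF subfield_multiquadratic[of p]]
  note act = act_spec[OF assms]
  have act_add: "act p g (a + b) = act p g a + act p g b"
    and act_mult: "act p g (a * b) = act p g a * act p g b" if "a \<in> ?K" "b \<in> ?K" for g a b
    using act(1)[of g] that unfolding rat_hom_on_def by blast+
  have act_rat: "act p g q = q" if "q \<in> \<rat>" for g q
    using act(1)[of g] that unfolding rat_hom_on_def by blast
  have act_0: "act p 0 a = a" if "a \<in> ?K" for a
    by (rule rat_hom_on_multiquadratic_unique[of p "act p 0" "\<lambda>z. z", OF act(1) rat_hom_on_id _ that])
      (simp add: act(3))
  have act_plus: "act p (g + h) a = act p g (act p h a)" if "a \<in> ?K" for g h a
  proof (rule rat_hom_on_multiquadratic_unique[OF act(1) _ _ that])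
    show "rat_hom_on ?K (\<lambda>a. act p g (act p h a))"
      unfolding rat_hom_on_def by (simp add: act(2) act_add act_mult act_rat)
    fix i
    have "(-1::real) powi k \<in> \<rat>" for k by (simp add: minus_one_powi)
    then show "act p (g + h) (sqrt (real (p i))) = act p g (act p h (sqrt (real (p i))))"
      using act_mult[OF subsetD[OF Rats_subset_multiquadratic] sqrt_in_multiquadratic]
      by (simp add: act(3) act_rat lookup_add power_int_add)
  qed
  show ?thesis
    by unfold_locales
      (use K act(2) act_add act_mult act_0 act_plus act_rat lookup_mono_0
        in \<open>simp_all add: lookup_add\<close>)
qed

theorem theorem4p6:
  fixes p :: "nat \<Rightarrow> nat"
    and D :: "(G \<Rightarrow> real) ring"
    and x :: "G \<Rightarrow> real"
    and H :: "(G \<Rightarrow> real) set"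
  assumes "strict_mono p" and "\<And>i. prime (p i)"
    and "D = MN p"
    and "x = single_term (- gen 1)"
    and "H = {a \<in> carrier (Multiplicative_Group.mult_of D). \<exists>n::int. val a \<ge> val (x [^]\<^bsub>D\<^esub> n)} \<union> {\<zero>\<^bsub>D\<^esub>}"
  shows "subring H D \<and> H \<noteq> carrier D
    \<and> Units (D\<lparr>carrier := H\<rparr>) \<lhd> Multiplicative_Group.mult_of D
    \<and> (\<exists>a \<in> Units (D\<lparr>carrier := H\<rparr>). \<exists>b \<in> Units (D\<lparr>carrier := H\<rparr>).
         a \<otimes>\<^bsub>D\<^esub> b \<noteq> b \<otimes>\<^bsub>D\<^esub> a)"
proof -
  have inj: "inj p" using assms(1) by (rule strict_mono_imp_inj_on)
  interpret C: coarsened_series "multiquadratic_field p" "act p" "\<lambda>g. Poly_Mapping.lookup g 0"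
    by (rule coarsened_series_MN[OF inj assms(2)])
  have D: "D = C.D" unfolding assms(3) MN_def ..
  have nonzero: "(single_term h :: G \<Rightarrow> real) \<noteq> \<zero>\<^bsub>D\<^esub>" for h
    by (auto simp: D C.zero_eq single_term_def fun_eq_iff)
  have val_single: "val (single_term h :: G \<Rightarrow> real) = h" for h
    unfolding single_term_def by (rule C.val_monomial) simp
  have val_x: "Poly_Mapping.lookup (val (x [^]\<^bsub>D\<^esub> n)) i = (if i = 1 then - n else 0)" for n :: int and i
    using C.val_int_pow[of "\<lambda>g. Poly_Mapping.lookup g i" x n]
      C.single_term_closed[of "- gen 1"] nonzero[of "- gen 1"]
    by (auto simp: assms(4) D val_single lookup_add gen_def lookup_single)
  \<comment> \<open>the powers of \<open>x\<close> have values \<open>(0, -n, 0, ...)\<close>, which bound \<open>g\<close> below for large \<open>n\<close> if \<open>g\<close> starts with \<open>0\<close>\<close>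
  have bounded: "(\<exists>n::int. val (x [^]\<^bsub>D\<^esub> n) \<le> g) \<longleftrightarrow> 0 \<le> Poly_Mapping.lookup g 0" for g
  proof
    assume "\<exists>n::int. val (x [^]\<^bsub>D\<^esub> n) \<le> g"
    then obtain n :: int where "val (x [^]\<^bsub>D\<^esub> n) \<le> g" by blast
    from lookup_mono_0[OF this] show "0 \<le> Poly_Mapping.lookup g 0" by (simp add: val_x)
  next
    assume g: "0 \<le> Poly_Mapping.lookup g 0"
    define n where "n = 1 - Poly_Mapping.lookup g 1"
    have "less_fun (Poly_Mapping.lookup (val (x [^]\<^bsub>D\<^esub> n))) (Poly_Mapping.lookup g)"
    proof (rule less_funI, cases "Poly_Mapping.lookup g 0 = 0")
      case True
      then show "\<exists>k. Poly_Mapping.lookup (val (x [^]\<^bsub>D\<^esub> n)) k < Poly_Mapping.lookup g k \<and>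
        (\<forall>k'<k. Poly_Mapping.lookup (val (x [^]\<^bsub>D\<^esub> n)) k' = Poly_Mapping.lookup g k')"
        by (intro exI[of _ 1]) (simp add: val_x n_def)
    next
      case False
      with g show "\<exists>k. Poly_Mapping.lookup (val (x [^]\<^bsub>D\<^esub> n)) k < Poly_Mapping.lookup g k \<and>
        (\<forall>k'<k. Poly_Mapping.lookup (val (x [^]\<^bsub>D\<^esub> n)) k' = Poly_Mapping.lookup g k')"
        by (intro exI[of _ 0]) (simp add: val_x)
    qed
    then have "val (x [^]\<^bsub>D\<^esub> n) < g" by (simp add: less_poly_mapping.rep_eq)
    then show "\<exists>n::int. val (x [^]\<^bsub>D\<^esub> n) \<le> g" by (blast intro: less_imp_le)
  qed
  have H: "H = C.valuation_ring"
    unfolding assms(5) C.valuation_ring_def bounded by (simp add: D)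
  let ?s = "sqrt (real (p 1))"
  define a where "a = (\<lambda>g::G. if g = 0 then ?s else 0)"
  define b where "b = (single_term (gen 1) :: G \<Rightarrow> real)"
  have p1: "0 < p 1" using assms(2) by (rule prime_gt_0_nat)
  have a: "a \<in> carrier D" "a \<noteq> \<zero>\<^bsub>D\<^esub>" "val a = 0"
    using C.monomial_closed[OF sqrt_in_multiquadratic, of 0] C.val_monomial[of ?s 0] p1
    by (auto simp: a_def D C.zero_eq fun_eq_iff)
  have b: "b \<in> carrier D" "b \<noteq> \<zero>\<^bsub>D\<^esub>" "val b = gen 1"
    using C.single_term_closed nonzero val_single by (simp_all add: b_def D)
  have units: "a \<in> Units (D\<lparr>carrier := H\<rparr>)" "b \<in> Units (D\<lparr>carrier := H\<rparr>)"
    using a b unfolding H D C.Units_valuation_ring_eq_kernel by (auto simp: kernel_def gen_def lookup_single)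
  have "(a \<otimes>\<^bsub>D\<^esub> b) (gen 1) = ?s"
    using C.monomial_mult_coeff[of b 0 ?s "gen 1"] b(1) C.phi_1[of 0]
    by (simp add: a_def D b_def single_term_def)
  moreover have "(b \<otimes>\<^bsub>D\<^esub> a) (gen 1) = - ?s"
    using C.monomial_mult_coeff[of a "gen 1" 1 "gen 1"] a(1) act_spec(3)[OF inj assms(2), of "gen 1" 1]
    by (simp add: D b_def single_term_def a_def gen_def)
  ultimately have "a \<otimes>\<^bsub>D\<^esub> b \<noteq> b \<otimes>\<^bsub>D\<^esub> a" using p1 by auto
  moreover have "single_term (- gen 0) \<in> carrier D - H"
    using C.single_term_closed nonzero unfolding H C.valuation_ring_def by (simp add: D val_single gen_def)
  ultimately show ?thesis
    using units C.subring_valuation_ring C.normal_Units_valuation_ring unfolding H D by blast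
qed

end
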